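(* Let $g \neq 0$ be a strongly operator convex function on $(0,\infty)$, i.e. $0\neq g\in\mathbf{SOC}(0,\infty)$, and let $A,B$ be positive invertible operators on a complex Hilbert space. Then $$g(A+B)\leq g(A)+g(B).$$
   Context: Operators are bounded linear operators on a complex Hilbert space $\mathcal{H}$ (nonzero, otherwise arbitrary). $A\ge 0$ (positive) means $\langle Ax,x\rangle\ge 0$ for all $x\in\mathcal{H}$; for self-adjoint $A,B$, $A\le B$ means $B-A\ge 0$. For a continuous real function $g$ on an interval $J$ and a self-adjoint $A$ with spectrum in $J$, $g(A)$ is the continuous functional calculus. A continuous real-valued function $g$ on an interval $J$ is strongly operator convex on $J$, written $g\in\mathbf{SOC}(J)$, if $P g(PAP)P\le g(A)$ for every self-adjoint operator $A$ (on any complex Hilbert space) with spectrum in $J$ and every orthogonal projection $P$; here $g(PAP)$ is computed for the compression of $A$ to the range of $P$, so $Pg(PAP)P$ equals $g(PAP|_{P\mathcal{H}})$ on $P\mathcal{H}$ and $0$ on $(P\mathcal{H})^\perp$. *)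

theory Defs
  imports
    "HOL-Analysis.Analysis"
    "HOL-Algebra.Module"
    "HOL-Computational_Algebra.Polynomial"
begin

section \<open>Complex Hilbert spaces with explicit carriers\<close>

text \<open>
  Strong operator convexity quantifies over all complex Hilbert spaces and passes to the range of
  a projection, so Hilbert spaces are carrier-based modules in the sense of HOL-Algebra rather
  than instances of a type class. The ring fields \<open>mult\<close> and \<open>one\<close> that the record of modules
  inherits are not used.
\<close>

definition complex_ring :: "complex ring" where
  "complex_ring = \<lparr>carrier = UNIV, mult = (*), one = 1, zero = 0, add = (+)\<rparr>"

record 'a hilbert = "(complex, 'a) module" +
  ip :: "'a \<Rightarrow> 'a \<Rightarrow> complex"

definition hnorm :: "('a, 'm) hilbert_scheme \<Rightarrow> 'a \<Rightarrow> real" where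
  "hnorm H x = sqrt (Re (ip H x x))"

text \<open>The value 0 off the carrier makes this a \<open>Metric_space\<close>, which restricts symmetry and
  nonnegativity of the distance not to the carrier but to the whole type.\<close>

definition hdist :: "('a, 'm) hilbert_scheme \<Rightarrow> 'a \<Rightarrow> 'a \<Rightarrow> real" where
  "hdist H x y =
    (if x \<in> carrier H \<and> y \<in> carrier H then hnorm H (x \<ominus>\<^bsub>H\<^esub> y) else 0)"

text \<open>The inner product is linear in the first argument.\<close>

locale complex_hilbert = Module.module complex_ring H for H :: "('a, 'm) hilbert_scheme" (structure) +
  assumes ip_add_left: "\<lbrakk>x \<in> carrier H; y \<in> carrier H; z \<in> carrier H\<rbrakk> \<Longrightarrow>
      ip H (x \<oplus>\<^bsub>H\<^esub> y) z = ip H x z + ip H y z"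
    and ip_smult_left: "\<lbrakk>x \<in> carrier H; y \<in> carrier H\<rbrakk> \<Longrightarrow>
      ip H (c \<odot>\<^bsub>H\<^esub> x) y = c * ip H x y"
    and ip_cnj: "\<lbrakk>x \<in> carrier H; y \<in> carrier H\<rbrakk> \<Longrightarrow> ip H y x = cnj (ip H x y)"
    and ip_pos: "\<lbrakk>x \<in> carrier H; x \<noteq> \<zero>\<^bsub>H\<^esub>\<rbrakk> \<Longrightarrow> Re (ip H x x) > 0"
    and complete: "Metric_space.mcomplete (carrier H) (hdist H)"

section \<open>Bounded operators\<close>

text \<open>Operators are \<open>undefined\<close> off the carrier, so that equality of operators is equality of
  functions.\<close>

definition bounded_op :: "('a, 'm) hilbert_scheme \<Rightarrow> ('a \<Rightarrow> 'a) \<Rightarrow> bool" where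
  "bounded_op H T \<longleftrightarrow>
     T \<in> carrier H \<rightarrow>\<^sub>E carrier H \<and>
     (\<forall>x\<in>carrier H. \<forall>y\<in>carrier H. T (x \<oplus>\<^bsub>H\<^esub> y) = T x \<oplus>\<^bsub>H\<^esub> T y) \<and>
     (\<forall>c. \<forall>x\<in>carrier H. T (c \<odot>\<^bsub>H\<^esub> x) = c \<odot>\<^bsub>H\<^esub> T x) \<and>
     (\<exists>K. \<forall>x\<in>carrier H. hnorm H (T x) \<le> K * hnorm H x)"

definition op_add :: "('a, 'm) hilbert_scheme \<Rightarrow> ('a \<Rightarrow> 'a) \<Rightarrow> ('a \<Rightarrow> 'a) \<Rightarrow> 'a \<Rightarrow> 'a" where
  "op_add H S T = (\<lambda>x\<in>carrier H. S x \<oplus>\<^bsub>H\<^esub> T x)"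

definition op_diff :: "('a, 'm) hilbert_scheme \<Rightarrow> ('a \<Rightarrow> 'a) \<Rightarrow> ('a \<Rightarrow> 'a) \<Rightarrow> 'a \<Rightarrow> 'a" where
  "op_diff H S T = (\<lambda>x\<in>carrier H. S x \<ominus>\<^bsub>H\<^esub> T x)"

definition op_norm :: "('a, 'm) hilbert_scheme \<Rightarrow> ('a \<Rightarrow> 'a) \<Rightarrow> real" where
  "op_norm H T = (SUP x\<in>{x \<in> carrier H. hnorm H x \<le> 1}. hnorm H (T x))"

definition self_adjoint :: "('a, 'm) hilbert_scheme \<Rightarrow> ('a \<Rightarrow> 'a) \<Rightarrow> bool" where
  "self_adjoint H T \<longleftrightarrow>
     bounded_op H T \<and> (\<forall>x\<in>carrier H. \<forall>y\<in>carrier H. ip H (T x) y = ip H x (T y))"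

text \<open>Membership in \<open>\<real>\<^sub>\<ge>\<^sub>0\<close> says that the complex number is real and nonnegative.\<close>

definition op_nonneg :: "('a, 'm) hilbert_scheme \<Rightarrow> ('a \<Rightarrow> 'a) \<Rightarrow> bool" where
  "op_nonneg H T \<longleftrightarrow> (\<forall>x\<in>carrier H. ip H (T x) x \<in> \<real>\<^sub>\<ge>\<^sub>0)"

definition op_le :: "('a, 'm) hilbert_scheme \<Rightarrow> ('a \<Rightarrow> 'a) \<Rightarrow> ('a \<Rightarrow> 'a) \<Rightarrow> bool" where
  "op_le H S T \<longleftrightarrow> op_nonneg H (op_diff H T S)"

definition op_invertible :: "('a, 'm) hilbert_scheme \<Rightarrow> ('a \<Rightarrow> 'a) \<Rightarrow> bool" where
  "op_invertible H T \<longleftrightarrow>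
     (\<exists>S. bounded_op H S \<and> (\<forall>x\<in>carrier H. S (T x) = x \<and> T (S x) = x))"

definition spectrum :: "('a, 'm) hilbert_scheme \<Rightarrow> ('a \<Rightarrow> 'a) \<Rightarrow> complex set" where
  "spectrum H T = {z. \<not> op_invertible H (op_diff H (\<lambda>x. z \<odot>\<^bsub>H\<^esub> x) T)}"

definition orth_proj :: "('a, 'm) hilbert_scheme \<Rightarrow> ('a \<Rightarrow> 'a) \<Rightarrow> bool" where
  "orth_proj H P \<longleftrightarrow> self_adjoint H P \<and> (\<forall>x\<in>carrier H. P (P x) = P x)"

section \<open>Continuous functional calculus\<close>

definition op_poly :: "('a, 'm) hilbert_scheme \<Rightarrow> real poly \<Rightarrow> ('a \<Rightarrow> 'a) \<Rightarrow> 'a \<Rightarrow> 'a" where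
  "op_poly H p A =
     (\<lambda>x\<in>carrier H. \<Oplus>\<^bsub>H\<^esub>i\<in>{..degree p}. complex_of_real (coeff p i) \<odot>\<^bsub>H\<^esub> (A ^^ i) x)"

text \<open>
  For self-adjoint \<open>A\<close> and \<open>g\<close> continuous on the spectrum of \<open>A\<close>, the operator \<open>g(A)\<close> is the norm
  limit of \<open>p\<^sub>n(A)\<close> for polynomials \<open>p\<^sub>n\<close> converging to \<open>g\<close> uniformly on the spectrum. Such
  polynomials exist by the Weierstrass theorem, so at most one operator satisfies the condition.
\<close>

definition cfc :: "('a, 'm) hilbert_scheme \<Rightarrow> (real \<Rightarrow> real) \<Rightarrow> ('a \<Rightarrow> 'a) \<Rightarrow> 'a \<Rightarrow> 'a" where
  "cfc H g A = (THE T. bounded_op H T \<and>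
     (\<forall>p. uniform_limit {t. complex_of_real t \<in> spectrum H A} (\<lambda>n. poly (p n)) g sequentially
        \<longrightarrow> (\<lambda>n. op_norm H (op_diff H (op_poly H (p n) A) T)) \<longlonglongrightarrow> 0))"

section \<open>Strongly operator convex functions\<close>

definition range_space :: "('a, 'm) hilbert_scheme \<Rightarrow> ('a \<Rightarrow> 'a) \<Rightarrow> ('a, 'm) hilbert_scheme" where
  "range_space H P = H\<lparr>carrier := P ` carrier H\<rparr>"

definition compression ::
  "('a, 'm) hilbert_scheme \<Rightarrow> ('a \<Rightarrow> 'a) \<Rightarrow> ('a \<Rightarrow> 'a) \<Rightarrow> 'a \<Rightarrow> 'a" where
  "compression H P A = (\<lambda>x\<in>P ` carrier H. P (A x))"

text \<open>\<open>P g(PAP) P\<close>, with \<open>g(PAP)\<close> computed on the range of \<open>P\<close>.\<close>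

definition cfc_compression ::
  "('a, 'm) hilbert_scheme \<Rightarrow> (real \<Rightarrow> real) \<Rightarrow> ('a \<Rightarrow> 'a) \<Rightarrow> ('a \<Rightarrow> 'a) \<Rightarrow> 'a \<Rightarrow> 'a" where
  "cfc_compression H g P A =
     (\<lambda>x\<in>carrier H. P (cfc (range_space H P) g (compression H P A) (P x)))"

text \<open>
  HOL cannot quantify over types inside a definition. The Hilbert spaces here are all those whose
  carrier is a subset of the universe \<open>'a\<close>, with arbitrary algebraic operations and inner product.
  If \<open>'a\<close> contains a nonzero Hilbert space \<open>K\<close>, then it also contains isometric copies of
  \<open>K \<oplus> K\<close> and of every Hilbert space of smaller cardinality, since \<open>K\<close> and \<open>K \<times> K\<close> are equinumerous.
\<close>

definition SOC :: "'a itself \<Rightarrow> real set \<Rightarrow> (real \<Rightarrow> real) set" where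
  "SOC U J = {g. is_interval J \<and> continuous_on J g \<and>
     (\<forall>(H :: 'a hilbert) A P.
        complex_hilbert H \<and> carrier H \<noteq> {\<zero>\<^bsub>H\<^esub>} \<and>
        self_adjoint H A \<and> spectrum H A \<subseteq> complex_of_real ` J \<and> orth_proj H P
        \<longrightarrow> op_le H (cfc_compression H g P A) (cfc H g A))}"

end

theory Submission
  imports Defs "HOL-Computational_Algebra.Fundamental_Theorem_Algebra"
begin

text \<open>
  Put \<open>D = diag(A, A + 2B)\<close> on \<open>H \<oplus> H\<close> and let \<open>P\<close> be the projection
  \<open>(x, y) \<mapsto> ((x + y)/2, (x + y)/2)\<close> onto the diagonal. The map \<open>x \<mapsto> (x, x)\<close> doubles inner
  products and turns the compression of \<open>D\<close> to the diagonal into the average of \<open>A\<close> and \<open>A + 2B\<close>,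
  which is \<open>A + B\<close>. Strong operator convexity says that \<open>P g(PDP) P \<le> g(D)\<close> on all of \<open>H \<oplus> H\<close>. At
  the vector \<open>(x, 0)\<close>, which \<open>P\<close> sends to \<open>(x/2, x/2)\<close>, this reads
  \<open>1/2 \<langle>g(A + B) x, x\<rangle> \<le> \<langle>g(A) x, x\<rangle>\<close> (lemma \<open>SOC_half_add\<close>). Exchanging \<open>A\<close> and \<open>B\<close> and adding
  the two inequalities gives the theorem.

  To make this precise, the space \<open>H \<oplus> H\<close> must be realised on a subset of the universe of \<open>H\<close>. A
  nonzero Hilbert space is infinite, so pairs of vectors can be encoded injectively as vectors, and
  the operations are transported along the encoding (locale \<open>encoded_square\<close>).

  The functional calculus is given by a definite description, so a comparison of \<open>g(A)\<close>,
  \<open>g(A + B)\<close>, \<open>g(D)\<close> and \<open>g(PDP)\<close> needs the existence of these operators. A self-adjoint operator with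
  quadratic form between \<open>a\<close> and \<open>b\<close> has its spectrum in \<open>[a, b]\<close> (\<open>spectrum_form_between\<close>), and the norm
  of \<open>p(A)\<close> is at most the supremum of \<open>|p|\<close> on the spectrum (\<open>hnorm_op_poly_le\<close>). With the Weierstrass theorem
  this makes \<open>g(A)\<close> the limit of \<open>p\<^sub>n(A)\<close> for all polynomials \<open>p\<^sub>n\<close> that converge to \<open>g\<close> uniformly on
  \<open>[a, b]\<close> (\<open>cfc_spec\<close>). Identities between polynomials of intertwined operators therefore pass to
  the limit (\<open>cfc_intertwining\<close>). This relates \<open>g(PDP)\<close> to \<open>g(A + B)\<close>, and \<open>g(D)\<close> at \<open>(x, 0)\<close> to
  \<open>g(A)\<close>.
  Positive invertible operators enter because their forms are bounded away from zero
  (\<open>positive_invertible_form_between\<close>), so that all spectra lie in one compact subinterval of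
  \<open>(0, \<infinity>)\<close>.
\<close>

section \<open>Inner product spaces with explicit carriers\<close>

text \<open>Completeness is left out, so that norms and the Cauchy-Schwarz inequality are at hand when
  a newly built space is shown to be complete.\<close>

locale inner_product_space = Module.module complex_ring H for H :: "('a, 'm) hilbert_scheme" (structure) +
  assumes ip_add_left: "\<lbrakk>x \<in> carrier H; y \<in> carrier H; z \<in> carrier H\<rbrakk> \<Longrightarrow>
      ip H (x \<oplus>\<^bsub>H\<^esub> y) z = ip H x z + ip H y z"
    and ip_smult_left: "\<lbrakk>x \<in> carrier H; y \<in> carrier H\<rbrakk> \<Longrightarrow>
      ip H (c \<odot>\<^bsub>H\<^esub> x) y = c * ip H x y"
    and ip_cnj: "\<lbrakk>x \<in> carrier H; y \<in> carrier H\<rbrakk> \<Longrightarrow> ip H y x = cnj (ip H x y)"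
    and ip_pos: "\<lbrakk>x \<in> carrier H; x \<noteq> \<zero>\<^bsub>H\<^esub>\<rbrakk> \<Longrightarrow> Re (ip H x x) > 0"
begin

lemma scale_closed [simp]: "x \<in> carrier H \<Longrightarrow> c \<odot> x \<in> carrier H"
  using smult_closed[of c x] by (simp add: complex_ring_def)

lemma scale_zero_left [simp]: "x \<in> carrier H \<Longrightarrow> 0 \<odot> x = \<zero>"
  using smult_l_null[of x] by (simp add: complex_ring_def)

lemma scale_zero_right [simp]: "c \<odot> \<zero> = \<zero>"
  using smult_r_null[of c] by (simp add: complex_ring_def)

lemma ip_zero_left [simp]: "x \<in> carrier H \<Longrightarrow> ip H \<zero> x = 0"
  using ip_smult_left[of \<zero> x 0] by simp

lemma ip_uminus_left: "\<lbrakk>x \<in> carrier H; y \<in> carrier H\<rbrakk> \<Longrightarrow> ip H (\<ominus> x) y = - ip H x y"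
  using ip_add_left[of x "\<ominus> x" y] by (simp add: M.r_neg add_eq_0_iff)

lemma ip_diff_left:
  "\<lbrakk>x \<in> carrier H; y \<in> carrier H; z \<in> carrier H\<rbrakk> \<Longrightarrow> ip H (x \<ominus> y) z = ip H x z - ip H y z"
  by (simp add: a_minus_def ip_add_left ip_uminus_left)

lemma ip_add_right:
  "\<lbrakk>x \<in> carrier H; y \<in> carrier H; z \<in> carrier H\<rbrakk> \<Longrightarrow> ip H z (x \<oplus> y) = ip H z x + ip H z y"
  using ip_cnj[of "x \<oplus> y" z] ip_cnj[of x z] ip_cnj[of y z] by (simp add: ip_add_left)

lemma ip_diff_right:
  "\<lbrakk>x \<in> carrier H; y \<in> carrier H; z \<in> carrier H\<rbrakk> \<Longrightarrow> ip H z (x \<ominus> y) = ip H z x - ip H z y"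
  using ip_cnj[of "x \<ominus> y" z] ip_cnj[of x z] ip_cnj[of y z] by (simp add: ip_diff_left)

lemma ip_smult_right:
  "\<lbrakk>x \<in> carrier H; y \<in> carrier H\<rbrakk> \<Longrightarrow> ip H x (c \<odot> y) = cnj c * ip H x y"
  using ip_cnj[of "c \<odot> y" x] ip_cnj[of y x] by (simp add: ip_smult_left)

lemma ip_zero_right [simp]: "x \<in> carrier H \<Longrightarrow> ip H x \<zero> = 0"
  using ip_cnj[of \<zero> x] by simp

lemmas ip_simps = ip_add_left ip_add_right ip_diff_left ip_diff_right ip_smult_left ip_smult_right

lemma ip_self: "x \<in> carrier H \<Longrightarrow> ip H x x = complex_of_real ((hnorm H x)\<^sup>2)"
proof -
  assume x: "x \<in> carrier H"
  have im: "Im (ip H x x) = 0"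
    using ip_cnj[OF x x] by (simp add: complex_eq_iff)
  have "0 \<le> Re (ip H x x)"
    using x ip_pos[OF x] by (cases "x = \<zero>") auto
  then show ?thesis
    using im by (simp add: hnorm_def complex_eq_iff)
qed

lemma hnorm_nonneg [simp]: "x \<in> carrier H \<Longrightarrow> 0 \<le> hnorm H x"
  using ip_pos[of x] by (cases "x = \<zero>") (auto simp: hnorm_def)

lemma hnorm_sq: "x \<in> carrier H \<Longrightarrow> (hnorm H x)\<^sup>2 = Re (ip H x x)"
  by (simp add: ip_self)

lemma hnorm_zero [simp]: "hnorm H \<zero> = 0"
  by (simp add: hnorm_def)

lemma hnorm_eq_0: "x \<in> carrier H \<Longrightarrow> hnorm H x = 0 \<longleftrightarrow> x = \<zero>"
  using ip_pos[of x] by (cases "x = \<zero>") (auto simp: hnorm_def)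

lemma hnorm_scale: "x \<in> carrier H \<Longrightarrow> hnorm H (c \<odot> x) = cmod c * hnorm H x"
proof -
  assume x: "x \<in> carrier H"
  have "ip H (c \<odot> x) (c \<odot> x) = complex_of_real ((cmod c)\<^sup>2 * (hnorm H x)\<^sup>2)"
    using x complex_norm_square[of c] by (simp add: ip_smult_left ip_smult_right ip_self[OF x])
  then have "hnorm H (c \<odot> x) = sqrt ((cmod c * hnorm H x)\<^sup>2)"
    unfolding hnorm_def[of H "c \<odot> x"] by (simp add: power_mult_distrib)
  then show ?thesis
    using x by simp
qed

lemma cauchy_schwarz:
  assumes x: "x \<in> carrier H" and y: "y \<in> carrier H"
  shows "cmod (ip H x y) \<le> hnorm H x * hnorm H y"
proof (cases "y = \<zero>")
  case True
  then show ?thesis using x by simp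
next
  case False
  define c where "c = ip H x y"
  define n where "n = (hnorm H y)\<^sup>2"
  have n: "n > 0"
    using False y hnorm_eq_0 unfolding n_def by simp
  have "0 \<le> (hnorm H (complex_of_real n \<odot> x \<ominus> c \<odot> y))\<^sup>2"
    by simp
  also have "\<dots> = n * (n * (hnorm H x)\<^sup>2 - (cmod c)\<^sup>2)"
  proof -
    have yx: "ip H y x = cnj c"
      using ip_cnj[OF x y] by (simp add: c_def)
    show ?thesis
      using x y unfolding hnorm_sq[OF M.minus_closed[OF scale_closed[OF x] scale_closed[OF y]]]
      by (simp add: ip_simps yx c_def[symmetric] ip_self[OF x] ip_self[OF y] n_def[symmetric] cmod_power2)
        (simp add: power2_eq_square algebra_simps)
  qed
  finally have "(cmod c)\<^sup>2 \<le> (hnorm H x * hnorm H y)\<^sup>2"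
    using n by (simp add: zero_le_mult_iff power_mult_distrib n_def mult.commute)
  then show ?thesis
    using x y by (simp add: c_def power2_le_iff_abs_le)
qed

lemma hnorm_triangle:
  assumes x: "x \<in> carrier H" and y: "y \<in> carrier H"
  shows "hnorm H (x \<oplus> y) \<le> hnorm H x + hnorm H y"
proof (rule power2_le_imp_le)
  have "(hnorm H (x \<oplus> y))\<^sup>2 = (hnorm H x)\<^sup>2 + 2 * Re (ip H x y) + (hnorm H y)\<^sup>2"
    using x y ip_cnj[OF x y] by (simp add: hnorm_sq ip_simps)
  also have "\<dots> \<le> (hnorm H x + hnorm H y)\<^sup>2"
    using cauchy_schwarz[OF x y] complex_Re_le_cmod[of "ip H x y"]
    by (simp add: power2_sum)
  finally show "(hnorm H (x \<oplus> y))\<^sup>2 \<le> (hnorm H x + hnorm H y)\<^sup>2" .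
qed (use x y in simp)

lemma diff_eq_zero_iff: "\<lbrakk>x \<in> carrier H; y \<in> carrier H\<rbrakk> \<Longrightarrow> x \<ominus> y = \<zero> \<longleftrightarrow> x = y"
  by (metis M.add.inv_solve_right M.l_zero M.minus_eq M.r_neg M.zero_closed)

text \<open>Vectors are determined by their inner products. This reduces an identity between vectors
  to one between complex numbers, where ring normalisation applies without closure conditions.\<close>

lemma vec_eqI:
  assumes x: "x \<in> carrier H" and y: "y \<in> carrier H"
    and eq: "\<And>z. z \<in> carrier H \<Longrightarrow> ip H x z = ip H y z"
  shows "x = y"
proof -
  have "ip H (x \<ominus> y) (x \<ominus> y) = 0"
    using x y eq[of "x \<ominus> y"] by (simp add: ip_diff_left)
  then have "x \<ominus> y = \<zero>"
    using x y ip_pos[of "x \<ominus> y"] by auto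
  then show ?thesis
    using x y by (simp add: diff_eq_zero_iff)
qed

lemma hnorm_diff_commute: "\<lbrakk>x \<in> carrier H; y \<in> carrier H\<rbrakk> \<Longrightarrow> hnorm H (x \<ominus> y) = hnorm H (y \<ominus> x)"
  by (simp add: hnorm_def ip_simps algebra_simps)

lemma hnorm_diff_triangle:
  assumes "x \<in> carrier H" "y \<in> carrier H" "z \<in> carrier H"
  shows "hnorm H (x \<ominus> z) \<le> hnorm H (x \<ominus> y) + hnorm H (y \<ominus> z)"
proof -
  have "x \<ominus> z = (x \<ominus> y) \<oplus> (y \<ominus> z)"
    using assms by (intro vec_eqI) (simp_all add: ip_simps)
  then show ?thesis
    using assms hnorm_triangle[of "x \<ominus> y" "y \<ominus> z"] by simp
qed

lemma hnorm_diff_eq_0: "\<lbrakk>x \<in> carrier H; y \<in> carrier H\<rbrakk> \<Longrightarrow> hnorm H (x \<ominus> y) = 0 \<longleftrightarrow> x = y"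
  by (simp add: hnorm_eq_0 diff_eq_zero_iff)

lemma metric_space: "Metric_space (carrier H) (hdist H)"
proof
  show "0 \<le> hdist H x y" for x y
    by (simp add: hdist_def)
  show "hdist H x y = hdist H y x" for x y
    by (simp add: hdist_def hnorm_diff_commute[of x y])
  show "hdist H x y = 0 \<longleftrightarrow> x = y" if "x \<in> carrier H" "y \<in> carrier H" for x y
    using that by (simp add: hdist_def hnorm_diff_eq_0)
  show "hdist H x z \<le> hdist H x y + hdist H y z"
    if "x \<in> carrier H" "y \<in> carrier H" "z \<in> carrier H" for x y z
    using that hnorm_diff_triangle[of x y z] by (simp add: hdist_def)
qed

text \<open>Completeness in terms of the norm alone. The distance \<open>hdist\<close> agrees with the norm of the
  difference only on the carrier, which contains every Cauchy sequence and every limit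
  considered here.\<close>

lemma mcomplete_iff:
  "Metric_space.mcomplete (carrier H) (hdist H) \<longleftrightarrow>
    (\<forall>s. range s \<subseteq> carrier H \<and> (\<forall>e>0. \<exists>N. \<forall>m\<ge>N. \<forall>n\<ge>N. hnorm H (s m \<ominus> s n) < e)
      \<longrightarrow> (\<exists>l\<in>carrier H. (\<lambda>n. hnorm H (s n \<ominus> l)) \<longlonglongrightarrow> 0))"
proof -
  interpret metric: Metric_space "carrier H" "hdist H"
    by (rule metric_space)
  have dist: "hdist H x y = hnorm H (x \<ominus> y)" if "x \<in> carrier H" "y \<in> carrier H" for x y
    using that by (simp add: hdist_def)
  have cauchy: "metric.MCauchy s \<longleftrightarrow> range s \<subseteq> carrier H \<and>
      (\<forall>e>0. \<exists>N. \<forall>m\<ge>N. \<forall>n\<ge>N. hnorm H (s m \<ominus> s n) < e)" for s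
  proof (cases "range s \<subseteq> carrier H")
    case True
    then have "s n \<in> carrier H" for n
      by auto
    then have eq: "hdist H (s m) (s n) = hnorm H (s m \<ominus> s n)" for m n
      by (simp add: dist)
    show ?thesis
      unfolding metric.MCauchy_def eq by (meson)
  qed (simp add: metric.MCauchy_def)
  have lim: "limitin metric.mtopology s l sequentially \<longleftrightarrow>
      l \<in> carrier H \<and> (\<lambda>n. hnorm H (s n \<ominus> l)) \<longlonglongrightarrow> 0" if "range s \<subseteq> carrier H" for s l
  proof (cases "l \<in> carrier H")
    case True
    have mem: "s n \<in> carrier H" for n
      using that by auto
    have eq: "hdist H (s n) l = hnorm H (s n \<ominus> l)" for n
      using mem True by (simp add: dist)
    have abs: "norm (hnorm H (s n \<ominus> l) - 0) = hnorm H (s n \<ominus> l)" for n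
      using mem True by simp
    show ?thesis
      unfolding metric.limit_metric_sequentially LIMSEQ_iff eq abs using mem True by simp
  qed (simp add: metric.limit_metric_sequentially)
  show ?thesis
    unfolding metric.mcomplete_def cauchy
  proof (intro iff_allI imp_cong refl)
    fix s :: "nat \<Rightarrow> 'a"
    assume "range s \<subseteq> carrier H \<and> (\<forall>e>0. \<exists>N. \<forall>m\<ge>N. \<forall>n\<ge>N. hnorm H (s m \<ominus> s n) < e)"
    then show "(\<exists>x. limitin metric.mtopology s x sequentially) =
        (\<exists>l\<in>carrier H. (\<lambda>n. hnorm H (s n \<ominus> l)) \<longlonglongrightarrow> 0)"
      by (simp add: lim Bex_def)
  qed
qed

end

sublocale complex_hilbert \<subseteq> inner_product_space
  by (intro inner_product_space.intro inner_product_space_axioms.intro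
      complex_hilbert.axioms(1)[OF complex_hilbert_axioms])
    (fact ip_add_left ip_smult_left ip_cnj ip_pos)+

section \<open>Bounded operators and the location of the spectrum\<close>

context inner_product_space begin

lemma bounded_op_closed: "\<lbrakk>bounded_op H T; x \<in> carrier H\<rbrakk> \<Longrightarrow> T x \<in> carrier H"
  unfolding bounded_op_def by auto

lemma bounded_op_add:
  "\<lbrakk>bounded_op H T; x \<in> carrier H; y \<in> carrier H\<rbrakk> \<Longrightarrow> T (x \<oplus> y) = T x \<oplus> T y"
  by (simp add: bounded_op_def)

lemma bounded_op_scale: "\<lbrakk>bounded_op H T; x \<in> carrier H\<rbrakk> \<Longrightarrow> T (c \<odot> x) = c \<odot> T x"
  by (simp add: bounded_op_def)

lemma bounded_op_zero: "bounded_op H T \<Longrightarrow> T \<zero> = \<zero>"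
  using bounded_op_scale[of T \<zero> 0] bounded_op_closed[of T \<zero>] by simp

lemma diff_conv_add_scale: "\<lbrakk>x \<in> carrier H; y \<in> carrier H\<rbrakk> \<Longrightarrow> x \<ominus> y = x \<oplus> (-1) \<odot> y"
  by (rule vec_eqI) (simp_all add: ip_simps)

lemma bounded_op_diff:
  "\<lbrakk>bounded_op H T; x \<in> carrier H; y \<in> carrier H\<rbrakk> \<Longrightarrow> T (x \<ominus> y) = T x \<ominus> T y"
  by (simp add: diff_conv_add_scale bounded_op_add bounded_op_scale bounded_op_closed)

lemma bounded_op_extensional: "bounded_op H T \<Longrightarrow> T \<in> extensional (carrier H)"
  by (simp add: bounded_op_def PiE_def)

lemma bounded_op_bound:
  assumes "bounded_op H T"
  obtains K where "0 < K" "\<And>x. x \<in> carrier H \<Longrightarrow> hnorm H (T x) \<le> K * hnorm H x"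
proof -
  obtain K where K: "\<And>x. x \<in> carrier H \<Longrightarrow> hnorm H (T x) \<le> K * hnorm H x"
    using assms unfolding bounded_op_def by blast
  show thesis
  proof (rule that[of "max K 1"])
    show "hnorm H (T x) \<le> max K 1 * hnorm H x" if x: "x \<in> carrier H" for x
      by (rule order_trans[OF K[OF x]]) (use x in \<open>simp add: mult_right_mono\<close>)
  qed simp
qed

lemma bounded_opI:
  assumes "T \<in> extensional (carrier H)"
    and "\<And>x. x \<in> carrier H \<Longrightarrow> T x \<in> carrier H"
    and "\<And>x y. \<lbrakk>x \<in> carrier H; y \<in> carrier H\<rbrakk> \<Longrightarrow> T (x \<oplus> y) = T x \<oplus> T y"
    and "\<And>c x. x \<in> carrier H \<Longrightarrow> T (c \<odot> x) = c \<odot> T x"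
    and "\<And>x. x \<in> carrier H \<Longrightarrow> hnorm H (T x) \<le> K * hnorm H x"
  shows "bounded_op H T"
  using assms unfolding bounded_op_def PiE_def by blast

lemma bounded_op_op_add:
  assumes S: "bounded_op H S" and T: "bounded_op H T"
  shows "bounded_op H (op_add H S T)"
proof -
  obtain K where K: "\<And>x. x \<in> carrier H \<Longrightarrow> hnorm H (S x) \<le> K * hnorm H x"
    using bounded_op_bound[OF S] by blast
  obtain L where L: "\<And>x. x \<in> carrier H \<Longrightarrow> hnorm H (T x) \<le> L * hnorm H x"
    using bounded_op_bound[OF T] by blast
  show ?thesis
  proof (rule bounded_opI[where K = "K + L"])
    show "hnorm H (op_add H S T x) \<le> (K + L) * hnorm H x" if x: "x \<in> carrier H" for x
      using hnorm_triangle[of "S x" "T x"] K[OF x] L[OF x] x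
      by (simp add: op_add_def bounded_op_closed[OF S] bounded_op_closed[OF T] distrib_right)
    show "op_add H S T (x \<oplus> y) = op_add H S T x \<oplus> op_add H S T y"
      if "x \<in> carrier H" "y \<in> carrier H" for x y
      using that bounded_op_closed[OF S] bounded_op_closed[OF T]
      by (simp add: op_add_def bounded_op_add[OF S] bounded_op_add[OF T] M.a_ac)
    show "op_add H S T (c \<odot> x) = c \<odot> op_add H S T x" if "x \<in> carrier H" for c x
      using that bounded_op_closed[OF S] bounded_op_closed[OF T]
      by (intro vec_eqI)
        (simp_all add: op_add_def bounded_op_scale[OF S] bounded_op_scale[OF T] ip_simps algebra_simps)
  qed (simp_all add: op_add_def bounded_op_closed[OF S] bounded_op_closed[OF T])
qed

lemma bounded_op_shift:
  assumes T: "bounded_op H T"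
  shows "bounded_op H (op_diff H (\<lambda>x. z \<odot> x) T)"
proof -
  obtain K where K: "\<And>x. x \<in> carrier H \<Longrightarrow> hnorm H (T x) \<le> K * hnorm H x"
    using bounded_op_bound[OF T] by blast
  show ?thesis
  proof (rule bounded_opI[where K = "cmod z + K"])
    show "hnorm H (op_diff H (\<lambda>x. z \<odot> x) T x) \<le> (cmod z + K) * hnorm H x"
      if x: "x \<in> carrier H" for x
      using hnorm_diff_triangle[of "z \<odot> x" \<zero> "T x"] K[OF x] x bounded_op_closed[OF T x]
        hnorm_diff_commute[of \<zero> "T x"] diff_conv_add_scale[of "T x" \<zero>]
        diff_conv_add_scale[of "z \<odot> x" \<zero>]
      by (simp add: op_diff_def distrib_right hnorm_scale)
    show "op_diff H (\<lambda>x. z \<odot> x) T (x \<oplus> y) = op_diff H (\<lambda>x. z \<odot> x) T x \<oplus> op_diff H (\<lambda>x. z \<odot> x) T y"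
      if "x \<in> carrier H" "y \<in> carrier H" for x y
      using that bounded_op_closed[OF T]
      by (intro vec_eqI) (simp_all add: op_diff_def bounded_op_add[OF T] ip_simps algebra_simps)
    show "op_diff H (\<lambda>x. z \<odot> x) T (c \<odot> x) = c \<odot> op_diff H (\<lambda>x. z \<odot> x) T x"
      if "x \<in> carrier H" for c x
      using that bounded_op_closed[OF T]
      by (intro vec_eqI) (simp_all add: op_diff_def bounded_op_scale[OF T] ip_simps algebra_simps)
  qed (simp_all add: op_diff_def bounded_op_closed[OF T])
qed

lemma bdd_above_op_norm:
  assumes K: "\<And>x. x \<in> carrier H \<Longrightarrow> hnorm H (T x) \<le> K * hnorm H x"
  shows "bdd_above ((\<lambda>x. hnorm H (T x)) ` {x \<in> carrier H. hnorm H x \<le> 1})"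
proof (rule bdd_aboveI2[where M = "\<bar>K\<bar>"])
  fix y assume y: "y \<in> {x \<in> carrier H. hnorm H x \<le> 1}"
  then have "hnorm H (T y) \<le> K * hnorm H y"
    using K by blast
  also have "\<dots> \<le> \<bar>K\<bar> * 1"
    using y by (intro mult_mono) auto
  finally show "hnorm H (T y) \<le> \<bar>K\<bar>" by simp
qed

lemma hnorm_le_op_norm:
  assumes T: "bounded_op H T" and x: "x \<in> carrier H"
  shows "hnorm H (T x) \<le> op_norm H T * hnorm H x"
proof (cases "x = \<zero>")
  case True
  then show ?thesis by (simp add: bounded_op_zero[OF T])
next
  case False
  obtain K where K: "\<And>x. x \<in> carrier H \<Longrightarrow> hnorm H (T x) \<le> K * hnorm H x"
    using bounded_op_bound[OF T] by blast
  define n where "n = hnorm H x"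
  have n: "n > 0"
    using False x hnorm_eq_0[OF x] hnorm_nonneg[OF x] unfolding n_def by linarith
  \<comment> \<open>The supremum in \<open>op_norm\<close> runs over the unit ball only.\<close>
  define u where "u = complex_of_real (1 / n) \<odot> x"
  have u: "u \<in> carrier H" "hnorm H u = 1"
    using x n by (simp_all add: u_def hnorm_scale n_def[symmetric] norm_divide)
  have "hnorm H (T u) \<le> op_norm H T"
    unfolding op_norm_def
  proof (rule cSUP_upper)
    show "bdd_above ((\<lambda>x. hnorm H (T x)) ` {x \<in> carrier H. hnorm H x \<le> 1})"
      using bdd_above_op_norm[OF K] .
  qed (use u in simp)
  also have "hnorm H (T u) = hnorm H (T x) / n"
    using x n by (simp add: u_def bounded_op_scale[OF T] bounded_op_closed[OF T] hnorm_scale norm_divide)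
  finally show ?thesis
    using n by (simp add: divide_le_eq n_def)
qed

lemma op_norm_le:
  assumes K: "\<And>x. x \<in> carrier H \<Longrightarrow> hnorm H (T x) \<le> K * hnorm H x" and "0 \<le> K"
  shows "op_norm H T \<le> K"
  unfolding op_norm_def
proof (rule cSUP_least)
  have "\<zero> \<in> {x \<in> carrier H. hnorm H x \<le> 1}"
    by simp
  then show "{x \<in> carrier H. hnorm H x \<le> 1} \<noteq> {}"
    by blast
  fix x assume x: "x \<in> {x \<in> carrier H. hnorm H x \<le> 1}"
  then have "hnorm H (T x) \<le> K * hnorm H x"
    using K by blast
  also have "\<dots> \<le> K * 1"
    using x \<open>0 \<le> K\<close> by (intro mult_mono) auto
  finally show "hnorm H (T x) \<le> K" by simp
qed

lemma op_norm_nonneg: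
  assumes K: "\<And>x. x \<in> carrier H \<Longrightarrow> hnorm H (T x) \<le> K * hnorm H x"
    and cl: "\<And>x. x \<in> carrier H \<Longrightarrow> T x \<in> carrier H"
  shows "0 \<le> op_norm H T"
proof -
  have "0 \<le> hnorm H (T \<zero>)"
    using cl by simp
  also have "\<dots> \<le> op_norm H T"
    unfolding op_norm_def
  proof (rule cSUP_upper)
    show "bdd_above ((\<lambda>x. hnorm H (T x)) ` {x \<in> carrier H. hnorm H x \<le> 1})"
      using bdd_above_op_norm[OF K] .
  qed simp
  finally show ?thesis .
qed

lemma bounded_op_op_diff:
  assumes S: "bounded_op H S" and T: "bounded_op H T"
  shows "bounded_op H (op_diff H S T)"
proof -
  have "op_diff H S T = op_add H S (op_diff H (\<lambda>x. 0 \<odot> x) T)"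
  proof (rule ext)
    fix x
    have "S x \<ominus> T x = S x \<oplus> (0 \<odot> x \<ominus> T x)" if "x \<in> carrier H"
      using that bounded_op_closed[OF S that] bounded_op_closed[OF T that]
      by (intro vec_eqI) (simp_all add: ip_simps)
    then show "op_diff H S T x = op_add H S (op_diff H (\<lambda>x. 0 \<odot> x) T) x"
      by (simp add: op_diff_def op_add_def)
  qed
  then show ?thesis
    using bounded_op_op_add[OF S bounded_op_shift[OF T]] by simp
qed

lemma hnorm_op_diff_le:
  assumes S: "bounded_op H S" and T: "bounded_op H T" and x: "x \<in> carrier H"
  shows "hnorm H (op_diff H S T x) \<le> op_norm H (op_diff H S T) * hnorm H x"
  by (rule hnorm_le_op_norm[OF bounded_op_op_diff[OF S T] x])

text \<open>Polarisation: that the form is real at \<open>x + y\<close> and at \<open>x + \<i>y\<close> says that \<open>\<langle>T x, y\<rangle>\<close> and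
  \<open>\<langle>T y, x\<rangle>\<close> have opposite imaginary parts and equal real parts.\<close>

lemma self_adjoint_of_real_form:
  assumes T: "bounded_op H T" and re: "\<And>x. x \<in> carrier H \<Longrightarrow> ip H (T x) x \<in> \<real>"
  shows "self_adjoint H T"
  unfolding self_adjoint_def
proof (intro conjI ballI T)
  fix x y assume x: "x \<in> carrier H" and y: "y \<in> carrier H"
  note cl = bounded_op_closed[OF T]
  have 1: "Im (ip H (T (x \<oplus> y)) (x \<oplus> y)) = 0" "Im (ip H (T (x \<oplus> \<i> \<odot> y)) (x \<oplus> \<i> \<odot> y)) = 0"
    "Im (ip H (T x) x) = 0" "Im (ip H (T y) y) = 0"
    using re[of "x \<oplus> y"] re[of "x \<oplus> \<i> \<odot> y"] re[of x] re[of y] x y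
    by (simp_all add: complex_is_Real_iff)
  have "ip H (T x) y = cnj (ip H (T y) x)"
    using 1 x y cl
    by (simp add: bounded_op_add[OF T] bounded_op_scale[OF T] ip_simps complex_eq_iff)
  then show "ip H (T x) y = ip H x (T y)"
    using ip_cnj[of "T y" x] cl x y by simp
qed

text \<open>The estimate makes \<open>T\<close> injective, and it is also the bound for the inverse.\<close>

lemma bounded_below_surj_invertible:
  assumes T: "bounded_op H T"
    and below: "\<And>x. x \<in> carrier H \<Longrightarrow> hnorm H x \<le> K * hnorm H (T x)"
    and surj: "\<And>y. y \<in> carrier H \<Longrightarrow> \<exists>x\<in>carrier H. T x = y"
  shows "op_invertible H T"
proof -
  note cl = bounded_op_closed[OF T]
  have inj: "x = y" if "x \<in> carrier H" "y \<in> carrier H" "T x = T y" for x y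
  proof -
    have "T (x \<ominus> y) = \<zero>"
      using that cl by (simp add: bounded_op_diff[OF T] diff_eq_zero_iff)
    then have "hnorm H (x \<ominus> y) \<le> 0"
      using below[of "x \<ominus> y"] that by simp
    then have "hnorm H (x \<ominus> y) = 0"
      using that by (intro antisym) simp_all
    then show ?thesis
      using that by (simp add: hnorm_diff_eq_0)
  qed
  define S where "S = (\<lambda>y\<in>carrier H. SOME x. x \<in> carrier H \<and> T x = y)"
  have S: "S y \<in> carrier H \<and> T (S y) = y" if "y \<in> carrier H" for y
    using someI_ex[of "\<lambda>x. x \<in> carrier H \<and> T x = y"] surj[OF that] that
    by (auto simp: S_def)
  have "bounded_op H S"
  proof (rule bounded_opI[where K = K])
    show "S (x \<oplus> y) = S x \<oplus> S y" if "x \<in> carrier H" "y \<in> carrier H" for x y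
      using that S by (rule_tac inj) (simp_all add: bounded_op_add[OF T])
    show "S (c \<odot> x) = c \<odot> S x" if "x \<in> carrier H" for c x
      using that S by (rule_tac inj) (simp_all add: bounded_op_scale[OF T])
    show "hnorm H (S x) \<le> K * hnorm H x" if "x \<in> carrier H" for x
      using below[of "S x"] S[OF that] by simp
  qed (use S in \<open>simp_all add: S_def\<close>)
  moreover have "S (T x) = x" if "x \<in> carrier H" for x
    using S[of "T x"] cl[OF that] inj[of "S (T x)" x] that by simp
  ultimately show ?thesis
    unfolding op_invertible_def using S by blast
qed

end

context complex_hilbert begin

text \<open>The Lax-Milgram lemma. An equation \<open>T x = y\<close> says that \<open>x\<close> is a fixed point of \<open>x \<mapsto> x - t
  w (T x - y)\<close>, and for a suitable \<open>t > 0\<close> coercivity makes this map a contraction. The factor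
  \<open>w\<close> allows the form of \<open>T\<close> to stay away from zero in any direction of the complex plane.\<close>

lemma coercive_invertible:
  assumes T: "bounded_op H T" and e: "e > 0" and w: "w \<noteq> 0"
    and coercive: "\<And>x. x \<in> carrier H \<Longrightarrow> e * (hnorm H x)\<^sup>2 \<le> Re (w * ip H (T x) x)"
  shows "op_invertible H T"
proof (rule bounded_below_surj_invertible[OF T])
  note cl = bounded_op_closed[OF T]
  show "hnorm H x \<le> (cmod w / e) * hnorm H (T x)" if x: "x \<in> carrier H" for x
  proof (cases "hnorm H x = 0")
    case False
    then have pos: "hnorm H x > 0"
      using hnorm_nonneg[OF x] by linarith
    have "e * (hnorm H x)\<^sup>2 \<le> cmod (w * ip H (T x) x)"
      using coercive[OF x] complex_Re_le_cmod order_trans by blast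
    also have "\<dots> \<le> cmod w * (hnorm H (T x) * hnorm H x)"
      using cauchy_schwarz[OF cl[OF x] x] by (simp add: norm_mult mult_left_mono)
    finally have "(e * hnorm H x) * hnorm H x \<le> (cmod w * hnorm H (T x)) * hnorm H x"
      by (simp add: power2_eq_square mult.assoc)
    then have "e * hnorm H x \<le> cmod w * hnorm H (T x)"
      using pos by simp
    then show ?thesis
      using e by (simp add: field_simps)
  qed (use x e cl in simp)
  obtain K where K: "0 < K" "\<And>x. x \<in> carrier H \<Longrightarrow> hnorm H (T x) \<le> K * hnorm H x"
    using bounded_op_bound[OF T] by blast
  \<comment> \<open>The summand \<open>e\<close> ensures \<open>e \<le> L\<close>, hence \<open>0 \<le> q\<close> below.\<close>
  define L where "L = cmod w * K + e"
  have L: "0 < L" "e \<le> L" "cmod w * K \<le> L"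
    using K(1) e by (simp_all add: L_def add_nonneg_pos)
  \<comment> \<open>This value minimises \<open>1 - 2 t e + t\<^sup>2 L\<^sup>2\<close>, the square of the contraction factor.\<close>
  define t where "t = e / L\<^sup>2"
  have t: "t > 0"
    using e L by (simp add: t_def)
  define q where "q = 1 - (e / L)\<^sup>2"
  have "(e / L)\<^sup>2 \<le> 1" "(e / L)\<^sup>2 > 0"
    using e L by (simp_all add: power_le_one)
  then have q: "0 \<le> q" "q < 1"
    by (simp_all add: q_def)
  have q_eq: "1 - 2 * t * e + t\<^sup>2 * L\<^sup>2 = q"
    using L by (simp add: t_def q_def power_divide) (simp add: field_simps power2_eq_square power4_eq_xxxx)
  define c where "c = complex_of_real t * w"
  have contr: "hnorm H (d \<ominus> c \<odot> T d) \<le> sqrt q * hnorm H d" if d: "d \<in> carrier H" for d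
  proof (rule power2_le_imp_le)
    have wT: "(cmod w * hnorm H (T d))\<^sup>2 \<le> (L * hnorm H d)\<^sup>2"
    proof (rule power_mono)
      have "cmod w * hnorm H (T d) \<le> cmod w * (K * hnorm H d)"
        using K(2)[OF d] by (simp add: mult_left_mono)
      also have "\<dots> \<le> L * hnorm H d"
        using L(3) d by (simp add: mult.assoc[symmetric] mult_right_mono)
      finally show "cmod w * hnorm H (T d) \<le> L * hnorm H d" .
    qed (use d cl in simp)
    have "ip H d (T d) = cnj (ip H (T d) d)"
      using ip_cnj[of "T d" d] d cl by simp
    then have "ip H (d \<ominus> c \<odot> T d) (d \<ominus> c \<odot> T d) = of_real ((hnorm H d)\<^sup>2)
        - (c * ip H (T d) d + cnj (c * ip H (T d) d)) + of_real ((cmod c)\<^sup>2 * (hnorm H (T d))\<^sup>2)"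
      using d cl complex_norm_square[of c]
      by (simp add: ip_simps ip_self[OF d] ip_self[OF cl[OF d]] algebra_simps)
    then have "(hnorm H (d \<ominus> c \<odot> T d))\<^sup>2
        = (hnorm H d)\<^sup>2 - 2 * Re (c * ip H (T d) d) + (cmod c)\<^sup>2 * (hnorm H (T d))\<^sup>2"
      using d cl by (simp add: hnorm_sq[of "d \<ominus> c \<odot> T d"])
    also have "Re (c * ip H (T d) d) = t * Re (w * ip H (T d) d)"
      by (simp add: c_def mult.assoc algebra_simps)
    also have "(cmod c)\<^sup>2 * (hnorm H (T d))\<^sup>2 = t\<^sup>2 * (cmod w * hnorm H (T d))\<^sup>2"
      by (simp add: c_def norm_mult power_mult_distrib)
    also have "(hnorm H d)\<^sup>2 - 2 * (t * Re (w * ip H (T d) d)) + t\<^sup>2 * (cmod w * hnorm H (T d))\<^sup>2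
        \<le> (hnorm H d)\<^sup>2 - 2 * (t * (e * (hnorm H d)\<^sup>2)) + t\<^sup>2 * (L * hnorm H d)\<^sup>2"
      using mult_left_mono[OF coercive[OF d] less_imp_le[OF t]] mult_left_mono[OF wT, of "t\<^sup>2"]
      by (metis add_mono diff_mono mult_left_mono order_refl zero_le_numeral zero_le_power2)
    also have "\<dots> = q * (hnorm H d)\<^sup>2"
      by (simp add: q_eq[symmetric] power_mult_distrib algebra_simps)
    finally show "(hnorm H (d \<ominus> c \<odot> T d))\<^sup>2 \<le> (sqrt q * hnorm H d)\<^sup>2"
      using q by (simp add: power_mult_distrib)
  qed (use q d in simp)
  fix y assume y: "y \<in> carrier H"
  define F where "F = (\<lambda>x. x \<ominus> c \<odot> (T x \<ominus> y))"
  have F_closed: "F x \<in> carrier H" if "x \<in> carrier H" for x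
    using that y cl by (simp add: F_def)
  have F_diff: "F x \<ominus> F z = (x \<ominus> z) \<ominus> c \<odot> T (x \<ominus> z)" if "x \<in> carrier H" "z \<in> carrier H" for x z
    using that y cl F_closed
    by (intro vec_eqI) (simp_all add: F_def bounded_op_diff[OF T] ip_simps algebra_simps)
  obtain x where x: "x \<in> carrier H" "F x = x"
  proof (rule Metric_space.Banach_fixedpoint_thm[OF metric_space complete])
    show "carrier H \<noteq> {}"
      using y by blast
    show "F \<in> carrier H \<rightarrow> carrier H"
      using F_closed by blast
    show "sqrt q < 1"
      using q by simp
    show "hdist H (F x) (F z) \<le> sqrt q * hdist H x z" if "x \<in> carrier H" "z \<in> carrier H" for x z
      using that F_closed contr[of "x \<ominus> z"] by (simp add: hdist_def F_diff)
  qed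
  have Tx: "T x \<in> carrier H"
    using cl x(1) by blast
  have "hnorm H (c \<odot> (T x \<ominus> y)) = 0"
  proof -
    have "c \<odot> (T x \<ominus> y) = x \<ominus> F x"
      using x(1) y Tx F_closed[OF x(1)]
      by (intro vec_eqI) (simp_all add: F_def ip_simps algebra_simps)
    also have "\<dots> = \<zero>"
      unfolding x(2) using x(1) by (simp add: diff_eq_zero_iff)
    finally show ?thesis
      by simp
  qed
  then have "hnorm H (T x \<ominus> y) = 0"
    using t w Tx y by (simp add: hnorm_scale c_def)
  then show "\<exists>x\<in>carrier H. T x = y"
    using x(1) Tx y hnorm_diff_eq_0 by blast
qed

end

text \<open>The operator inequality \<open>a \<le> A \<le> b\<close>, stated through the quadratic form. A real form makes
  \<open>A\<close> self-adjoint.\<close>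

definition form_between :: "('a, 'm) hilbert_scheme \<Rightarrow> real \<Rightarrow> real \<Rightarrow> ('a \<Rightarrow> 'a) \<Rightarrow> bool" where
  "form_between H a b A \<longleftrightarrow> bounded_op H A \<and>
     (\<forall>x\<in>carrier H. ip H (A x) x \<in> \<real> \<and>
        a * (hnorm H x)\<^sup>2 \<le> Re (ip H (A x) x) \<and> Re (ip H (A x) x) \<le> b * (hnorm H x)\<^sup>2)"

context complex_hilbert begin

text \<open>For \<open>z\<close> outside \<open>[a, b]\<close> the form \<open>z \<parallel>x\<parallel>\<^sup>2 - \<langle>A x, x\<rangle>\<close> of \<open>z - A\<close> is coercive in a
  suitable direction \<open>w\<close>, so \<open>z - A\<close> is invertible.\<close>

lemma spectrum_form_between:
  assumes A: "form_between H a b A"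
  shows "spectrum H A \<subseteq> complex_of_real ` {a..b}"
proof
  have bA: "bounded_op H A"
    using A by (simp add: form_between_def)
  note cl = bounded_op_closed[OF bA]
  fix z assume z: "z \<in> spectrum H A"
  have form: "ip H (op_diff H (\<lambda>x. z \<odot> x) A x) x
      = z * of_real ((hnorm H x)\<^sup>2) - of_real (Re (ip H (A x) x))" if "x \<in> carrier H" for x
    using A that cl by (simp add: op_diff_def ip_simps ip_self[OF that] form_between_def)
  have ab: "a * (hnorm H x)\<^sup>2 \<le> Re (ip H (A x) x)" "Re (ip H (A x) x) \<le> b * (hnorm H x)\<^sup>2"
    if "x \<in> carrier H" for x
    using A that by (simp_all add: form_between_def)
  have no: False
    if "w \<noteq> 0" "e > 0" "\<And>x. x \<in> carrier H \<Longrightarrow> e * (hnorm H x)\<^sup>2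
      \<le> Re (w * (z * of_real ((hnorm H x)\<^sup>2) - of_real (Re (ip H (A x) x))))" for w e
    using z coercive_invertible[OF bounded_op_shift[OF bA, of z] that(2,1)] that(3)
    unfolding spectrum_def by (simp add: form)
  have im: "Im z = 0"
  proof (rule ccontr)
    assume "Im z \<noteq> 0"
    then show False
      by (intro no[of "- \<i> * of_real (Im z)" "(Im z)\<^sup>2"])
        (auto simp: power2_eq_square algebra_simps zero_less_mult_iff linorder_neq_iff)
  qed
  have "a \<le> Re z"
  proof (rule ccontr)
    assume "\<not> a \<le> Re z"
    then show False
      using ab by (intro no[of "-1" "a - Re z"]) (simp_all add: algebra_simps)
  qed
  moreover have "Re z \<le> b"
  proof (rule ccontr)
    assume "\<not> Re z \<le> b"
    then show False
      using ab by (intro no[of 1 "Re z - b"]) (simp_all add: algebra_simps)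
  qed
  moreover have "z = complex_of_real (Re z)"
    using im by (simp add: complex_eq_iff)
  ultimately show "z \<in> complex_of_real ` {a..b}"
    by (metis atLeastAtMost_iff imageI)
qed

end

section \<open>Polynomials of an operator\<close>

context inner_product_space begin

text \<open>Evaluation by the Horner scheme, which turns induction over \<open>pCons\<close> into the proof method
  for all algebraic laws. The coefficients are complex so that polynomials split into linear
  factors.\<close>

definition cpoly_op :: "('a \<Rightarrow> 'a) \<Rightarrow> complex poly \<Rightarrow> 'a \<Rightarrow> 'a" where
  "cpoly_op A p x = fold_coeffs (\<lambda>c y. c \<odot> x \<oplus> A y) p \<zero>"

lemma cpoly_op_0 [simp]: "cpoly_op A 0 x = \<zero>"
  by (simp add: cpoly_op_def)

lemma cpoly_op_pCons:
  assumes A: "bounded_op H A" and x: "x \<in> carrier H"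
  shows "cpoly_op A (pCons c p) x = c \<odot> x \<oplus> A (cpoly_op A p x)"
proof (cases "p = 0 \<and> c = 0")
  case True
  then show ?thesis
    using x by (simp add: bounded_op_zero[OF A])
next
  case False
  then show ?thesis
    by (cases "p = 0") (auto simp: cpoly_op_def)
qed

context
  fixes A
  assumes A: "bounded_op H A"
begin

lemma cpoly_op_closed [simp]: "x \<in> carrier H \<Longrightarrow> cpoly_op A p x \<in> carrier H"
  by (induction p) (simp_all add: cpoly_op_pCons[OF A] bounded_op_closed[OF A])

lemma cpoly_op_add:
  "x \<in> carrier H \<Longrightarrow> cpoly_op A (p + q) x = cpoly_op A p x \<oplus> cpoly_op A q x"
proof (induction p q rule: poly_induct2)
  case (pCons a p b q)
  then show ?case
    by (intro vec_eqI)
      (simp_all add: cpoly_op_pCons[OF A] bounded_op_add[OF A] bounded_op_closed[OF A] ip_simps algebra_simps)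
qed simp

lemma cpoly_op_smult:
  "x \<in> carrier H \<Longrightarrow> cpoly_op A (Polynomial.smult c p) x = c \<odot> cpoly_op A p x"
proof (induction p)
  case (pCons a p)
  then show ?case
    by (intro vec_eqI)
      (simp_all add: cpoly_op_pCons[OF A] bounded_op_scale[OF A] bounded_op_closed[OF A] ip_simps algebra_simps)
qed simp

lemma cpoly_op_diff:
  "x \<in> carrier H \<Longrightarrow> cpoly_op A (p - q) x = cpoly_op A p x \<ominus> cpoly_op A q x"
  using cpoly_op_add[of x p "Polynomial.smult (-1) q"] cpoly_op_smult[of x "-1" q]
  by (simp add: diff_conv_add_scale)

lemma cpoly_op_mult:
  "x \<in> carrier H \<Longrightarrow> cpoly_op A (p * q) x = cpoly_op A p (cpoly_op A q x)"
  by (induction p) (simp_all add: cpoly_op_pCons[OF A] cpoly_op_add cpoly_op_smult bounded_op_closed[OF A])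

lemma cpoly_op_vec_add:
  "\<lbrakk>x \<in> carrier H; y \<in> carrier H\<rbrakk> \<Longrightarrow> cpoly_op A p (x \<oplus> y) = cpoly_op A p x \<oplus> cpoly_op A p y"
proof (induction p)
  case (pCons a p)
  then show ?case
    by (intro vec_eqI)
      (simp_all add: cpoly_op_pCons[OF A] bounded_op_add[OF A] bounded_op_closed[OF A] ip_simps algebra_simps)
qed simp

lemma cpoly_op_vec_scale:
  "x \<in> carrier H \<Longrightarrow> cpoly_op A p (c \<odot> x) = c \<odot> cpoly_op A p x"
proof (induction p)
  case (pCons a p)
  then show ?case
    by (intro vec_eqI)
      (simp_all add: cpoly_op_pCons[OF A] bounded_op_scale[OF A] bounded_op_closed[OF A] ip_simps algebra_simps)
qed simp

lemma cpoly_op_commute: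
  "x \<in> carrier H \<Longrightarrow> cpoly_op A p (A x) = A (cpoly_op A p x)"
  by (induction p) (simp_all add: cpoly_op_pCons[OF A] bounded_op_closed[OF A] bounded_op_zero[OF A]
      bounded_op_add[OF A] bounded_op_scale[OF A])

lemma cpoly_op_bound: "\<exists>K. \<forall>x\<in>carrier H. hnorm H (cpoly_op A p x) \<le> K * hnorm H x"
proof (induction p)
  case 0
  show ?case
    by (intro exI[of _ 0]) simp
next
  case (pCons a p)
  obtain L where L: "0 < L" "\<And>x. x \<in> carrier H \<Longrightarrow> hnorm H (A x) \<le> L * hnorm H x"
    using bounded_op_bound[OF A] by blast
  obtain K where K: "\<And>x. x \<in> carrier H \<Longrightarrow> hnorm H (cpoly_op A p x) \<le> K * hnorm H x"
    using pCons by blast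
  have "hnorm H (cpoly_op A (pCons a p) x) \<le> (cmod a + L * K) * hnorm H x" if x: "x \<in> carrier H" for x
  proof -
    have "hnorm H (A (cpoly_op A p x)) \<le> L * hnorm H (cpoly_op A p x)"
      using L(2) x by simp
    also have "\<dots> \<le> L * (K * hnorm H x)"
      using L(1) K[OF x] by simp
    finally show ?thesis
      using hnorm_triangle[of "a \<odot> x" "A (cpoly_op A p x)"] x
      by (simp add: cpoly_op_pCons[OF A] bounded_op_closed[OF A] hnorm_scale algebra_simps)
  qed
  then show ?case by blast
qed

lemma bounded_op_finsum:
  assumes "\<And>i. f i \<in> carrier H"
  shows "A (\<Oplus>i\<in>{..n::nat}. f i) = (\<Oplus>i\<in>{..n}. A (f i))"
  by (induction n)
    (simp_all add: assms M.finsum_Suc Pi_def bounded_op_closed[OF A] bounded_op_add[OF A] M.finsum_0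
      M.finsum_closed)

lemma funpow_closed: "x \<in> carrier H \<Longrightarrow> (A ^^ i) x \<in> carrier H"
  by (induction i) (simp_all add: bounded_op_closed[OF A])

lemma op_poly_eq_cpoly_op:
  "x \<in> carrier H \<Longrightarrow> op_poly H p A x = cpoly_op A (map_poly complex_of_real p) x"
proof (induction p)
  case 0
  then show ?case
    by (simp add: op_poly_def M.finsum_0)
next
  case (pCons a p)
  note x = \<open>x \<in> carrier H\<close>
  note cl = bounded_op_closed[OF A] funpow_closed[OF x]
  have IH: "(\<Oplus>i\<in>{..degree p}. complex_of_real (coeff p i) \<odot> (A ^^ i) x)
      = cpoly_op A (map_poly complex_of_real p) x"
    using pCons.IH[OF x] x by (simp add: op_poly_def)
  show ?case
  proof (cases "p = 0")
    case True
    then show ?thesis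
      using x by (simp add: op_poly_def M.finsum_0 map_poly_pCons cpoly_op_pCons[OF A] bounded_op_zero[OF A])
  next
    case False
    have "op_poly H (pCons a p) A x = (\<Oplus>i\<in>{..Suc (degree p)}. complex_of_real (coeff (pCons a p) i) \<odot> (A ^^ i) x)"
      using False x by (simp add: op_poly_def)
    also have "\<dots> = (\<Oplus>i\<in>{..degree p}. complex_of_real (coeff p i) \<odot> A ((A ^^ i) x)) \<oplus> complex_of_real a \<odot> x"
      by (subst M.finsum_Suc2) (use x cl in auto)
    also have "(\<Oplus>i\<in>{..degree p}. complex_of_real (coeff p i) \<odot> A ((A ^^ i) x))
        = A (\<Oplus>i\<in>{..degree p}. complex_of_real (coeff p i) \<odot> (A ^^ i) x)"
      using cl by (simp add: bounded_op_finsum bounded_op_scale[OF A])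
    finally show ?thesis
      using x cl by (simp add: IH map_poly_pCons cpoly_op_pCons[OF A] M.a_comm)
  qed
qed

lemma cpoly_op_self_adjoint:
  assumes sa: "self_adjoint H A" and x: "x \<in> carrier H" and y: "y \<in> carrier H"
  shows "ip H (cpoly_op A (map_poly complex_of_real p) x) y
    = ip H x (cpoly_op A (map_poly complex_of_real p) y)"
  using y
proof (induction p arbitrary: y)
  case (pCons a p)
  have "ip H (A (cpoly_op A (map_poly complex_of_real p) x)) y
      = ip H (cpoly_op A (map_poly complex_of_real p) x) (A y)"
    using sa x pCons.prems by (simp add: self_adjoint_def)
  also have "\<dots> = ip H x (A (cpoly_op A (map_poly complex_of_real p) y))"
    using pCons.IH[of "A y"] pCons.prems by (simp add: bounded_op_closed[OF A] cpoly_op_commute)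
  finally show ?case
    using x pCons.prems
    by (simp add: map_poly_pCons cpoly_op_pCons[OF A] bounded_op_closed[OF A] ip_simps)
qed (use x in simp)

lemma bounded_op_op_poly: "bounded_op H (op_poly H p A)"
proof -
  obtain K where K: "\<And>x. x \<in> carrier H \<Longrightarrow> hnorm H (cpoly_op A (map_poly complex_of_real p) x) \<le> K * hnorm H x"
    using cpoly_op_bound by blast
  have "op_poly H p A \<in> extensional (carrier H)"
    by (simp add: op_poly_def)
  then show ?thesis
    by (rule bounded_opI[where K = K])
      (simp_all add: op_poly_eq_cpoly_op cpoly_op_vec_add cpoly_op_vec_scale K)
qed

lemma bounded_below_off_spectrum:
  assumes "z \<notin> spectrum H A"
  shows "\<exists>K>0. \<forall>x\<in>carrier H. hnorm H x \<le> K * hnorm H (z \<odot> x \<ominus> A x)"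
proof -
  obtain S where S: "bounded_op H S"
      "\<And>x. x \<in> carrier H \<Longrightarrow> S (op_diff H (\<lambda>x. z \<odot> x) A x) = x"
    using assms unfolding spectrum_def op_invertible_def by blast
  obtain K where K: "0 < K" "\<And>x. x \<in> carrier H \<Longrightarrow> hnorm H (S x) \<le> K * hnorm H x"
    using bounded_op_bound[OF S(1)] by blast
  have "hnorm H x \<le> K * hnorm H (z \<odot> x \<ominus> A x)" if "x \<in> carrier H" for x
    using K(2)[of "z \<odot> x \<ominus> A x"] S(2)[OF that] that bounded_op_closed[OF A that]
    by (simp add: op_diff_def)
  then show ?thesis
    using K(1) by blast
qed

text \<open>Over the complex numbers \<open>q\<close> splits into linear factors \<open>X - z\<close>; none of the roots \<open>z\<close>
  lies in the spectrum, so every factor \<open>A - z\<close> is bounded below, and so is their product.\<close>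

lemma cpoly_op_bounded_below:
  assumes "q \<noteq> 0" and "\<And>z. poly q z = 0 \<Longrightarrow> z \<notin> spectrum H A"
  shows "\<exists>K>0. \<forall>x\<in>carrier H. hnorm H x \<le> K * hnorm H (cpoly_op A q x)"
  using assms
proof (induction "degree q" arbitrary: q)
  case 0
  then obtain c where q: "q = [:c:]"
    using degree_eq_zeroE by metis
  with 0 have "c \<noteq> 0" by simp
  then show ?case
    by (intro exI[of _ "1 / cmod c"])
      (simp add: q cpoly_op_pCons[OF A] bounded_op_zero[OF A] hnorm_scale)
next
  case (Suc n)
  have "\<not> constant (poly q)"
    using Suc.hyps(2) constant_degree[of q] by simp
  then obtain z where z: "poly q z = 0"
    using fundamental_theorem_of_algebra by blast
  then obtain r where r: "q = [:- z, 1:] * r"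
    using poly_eq_0_iff_dvd by blast
  with Suc.prems(1) have "r \<noteq> 0" by auto
  then have "degree q = Suc (degree r)"
    unfolding r by (subst degree_mult_eq) auto
  then obtain K where K: "K > 0" "\<And>x. x \<in> carrier H \<Longrightarrow> hnorm H x \<le> K * hnorm H (cpoly_op A r x)"
    using Suc.hyps(1)[of r] Suc.hyps(2) Suc.prems(2) \<open>r \<noteq> 0\<close> r by auto
  obtain L where L: "L > 0" "\<And>x. x \<in> carrier H \<Longrightarrow> hnorm H x \<le> L * hnorm H (z \<odot> x \<ominus> A x)"
    using bounded_below_off_spectrum[OF Suc.prems(2)[OF z]] by blast
  have "hnorm H x \<le> (K * L) * hnorm H (cpoly_op A q x)" if x: "x \<in> carrier H" for x
  proof -
    define y where "y = cpoly_op A r x"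
    have y: "y \<in> carrier H"
      using x by (simp add: y_def)
    have "cpoly_op A q x = cpoly_op A [:- z, 1:] y"
      unfolding r y_def by (rule cpoly_op_mult[OF x])
    also have "\<dots> = (- 1) \<odot> (z \<odot> y \<ominus> A y)"
      using y bounded_op_closed[OF A y]
      by (intro vec_eqI) (simp_all add: cpoly_op_pCons[OF A] bounded_op_zero[OF A]
          bounded_op_scale[OF A] ip_simps)
    finally have "cpoly_op A q x = (- 1) \<odot> (z \<odot> y \<ominus> A y)" .
    then have "hnorm H (cpoly_op A q x) = hnorm H (z \<odot> y \<ominus> A y)"
      using y bounded_op_closed[OF A y] by (simp add: hnorm_scale)
    then have "hnorm H y \<le> L * hnorm H (cpoly_op A q x)"
      using L(2)[OF y] by simp
    then have "K * hnorm H y \<le> K * (L * hnorm H (cpoly_op A q x))"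
      using K(1) by simp
    then show ?thesis
      using K(2)[OF x] by (simp add: y_def mult.assoc)
  qed
  then show ?case
    using K(1) L(1) by (intro exI[of _ "K * L"]) simp
qed

end

end

lemma poly_map_poly_of_real:
  "poly (map_poly complex_of_real p) (complex_of_real t) = complex_of_real (poly p t)"
  by (induction p) (simp_all add: map_poly_pCons)

lemma map_poly_of_real_diff:
  "map_poly complex_of_real (p - q) = map_poly complex_of_real p - map_poly complex_of_real q"
  by (rule poly_eqI) (simp add: coeff_map_poly)

lemma map_poly_of_real_mult:
  "map_poly complex_of_real (p * q) = map_poly complex_of_real p * map_poly complex_of_real q"
  by (rule poly_eqI) (simp add: coeff_map_poly coeff_mult)

lemma map_poly_of_real_eq_0: "map_poly complex_of_real p = 0 \<longleftrightarrow> p = 0"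
  by (simp add: poly_eq_iff coeff_map_poly)

context complex_hilbert begin

lemma form_betweenD:
  assumes "form_between H a b A"
  shows "bounded_op H A" and "self_adjoint H A" 
  using assms self_adjoint_of_real_form by (auto simp: form_between_def)

text \<open>Put \<open>P = p(A)\<close> and \<open>N = \<parallel>P\<parallel>\<close>. If \<open>N > c\<close>, then \<open>N\<^sup>2 - p\<^sup>2\<close> has no zero on the spectrum, so
  \<open>N\<^sup>2 - P\<^sup>2\<close> is bounded below. On the other hand \<open>\<parallel>(N\<^sup>2 - P\<^sup>2) x\<parallel>\<^sup>2 \<le> N\<^sup>2 (N\<^sup>2 \<parallel>x\<parallel>\<^sup>2 - \<parallel>P
  x\<parallel>\<^sup>2)\<close>, because \<open>P\<close> is self-adjoint of norm \<open>N\<close>. Together these estimates bound \<open>P\<close> by a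
  constant smaller than its norm. The last assumption excludes only the constant polynomials \<open>p
  = \<plusminus>N\<close>; they are treated in \<open>hnorm_op_poly_le\<close>, after it is known that the spectrum is not
  empty.\<close>

lemma op_norm_op_poly_le_if_noncst:
  assumes A: "form_between H a b A" and c: "0 \<le> c"
    and spec: "\<And>t. complex_of_real t \<in> spectrum H A \<Longrightarrow> \<bar>poly p t\<bar> \<le> c"
    and nz: "[:(op_norm H (op_poly H p A))\<^sup>2:] - p * p \<noteq> 0"
  shows "op_norm H (op_poly H p A) \<le> c"
proof (rule ccontr)
  define N where "N = op_norm H (op_poly H p A)"
  assume "\<not> op_norm H (op_poly H p A) \<le> c"
  then have N: "c < N" by (simp add: N_def)
  note bA = form_betweenD(1)[OF A]
  define P where "P = cpoly_op A (map_poly complex_of_real p)"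
  have P: "P x \<in> carrier H" if "x \<in> carrier H" for x
    using that bA by (simp add: P_def cpoly_op_closed)
  have PN: "hnorm H (P x) \<le> N * hnorm H x" if x: "x \<in> carrier H" for x
  proof -
    have "hnorm H (op_poly H p A x) \<le> op_norm H (op_poly H p A) * hnorm H x"
      by (rule hnorm_le_op_norm[OF bounded_op_op_poly[OF bA] x])
    then show ?thesis
      using x by (simp add: N_def P_def op_poly_eq_cpoly_op[OF bA])
  qed
  define q where "q = [:N\<^sup>2:] - p * p"
  have "z \<notin> spectrum H A" if "poly (map_poly complex_of_real q) z = 0" for z
  proof
    assume z: "z \<in> spectrum H A"
    then obtain t where t: "z = complex_of_real t"
      using spectrum_form_between[OF A] by blast
    have "poly q t = 0"
      using that by (simp add: t poly_map_poly_of_real)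
    then have "N\<^sup>2 = (poly p t)\<^sup>2"
      by (simp add: q_def power2_eq_square)
    also have "\<dots> \<le> c\<^sup>2"
      using spec[of t] z t c by (simp add: abs_le_square_iff[symmetric])
    finally show False
      using N c by (simp add: power2_le_iff_abs_le)
  qed
  then obtain K where K: "K > 0"
      "\<And>x. x \<in> carrier H \<Longrightarrow> hnorm H x \<le> K * hnorm H (cpoly_op A (map_poly complex_of_real q) x)"
    using cpoly_op_bounded_below[OF bA, of "map_poly complex_of_real q"] nz
    unfolding map_poly_of_real_eq_0 q_def N_def by blast
  \<comment> \<open>Solving \<open>\<parallel>x\<parallel>\<^sup>2 \<le> K\<^sup>2 N\<^sup>2 (N\<^sup>2 \<parallel>x\<parallel>\<^sup>2 - \<parallel>P x\<parallel>\<^sup>2)\<close> for \<open>\<parallel>P x\<parallel>\<^sup>2\<close> gives this factor.\<close>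
  define m where "m = N\<^sup>2 - 1 / (K\<^sup>2 * N\<^sup>2)"
  have Pm: "(hnorm H (P x))\<^sup>2 \<le> m * (hnorm H x)\<^sup>2" if x: "x \<in> carrier H" for x
  proof -
    have "map_poly complex_of_real q = [:complex_of_real (N\<^sup>2):] - map_poly complex_of_real p * map_poly complex_of_real p"
      by (simp add: q_def map_poly_of_real_diff map_poly_of_real_mult map_poly_pCons)
    then have qx: "cpoly_op A (map_poly complex_of_real q) x = complex_of_real (N\<^sup>2) \<odot> x \<ominus> P (P x)"
      using x bA by (simp add: P_def cpoly_op_diff cpoly_op_mult cpoly_op_pCons bounded_op_zero)
    \<comment> \<open>The middle terms of the expanded square, by self-adjointness of \<open>P\<close>.\<close>
    have sym: "ip H (P (P x)) x = of_real ((hnorm H (P x))\<^sup>2)" "ip H x (P (P x)) = of_real ((hnorm H (P x))\<^sup>2)"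
      using cpoly_op_self_adjoint[OF bA form_betweenD(2)[OF A] P[OF x] x, of p]
        cpoly_op_self_adjoint[OF bA form_betweenD(2)[OF A] x P[OF x], of p] ip_self[OF P[OF x]]
      by (simp_all add: P_def)
    have "ip H (complex_of_real (N\<^sup>2) \<odot> x \<ominus> P (P x)) (complex_of_real (N\<^sup>2) \<odot> x \<ominus> P (P x))
      = of_real (N\<^sup>2 * N\<^sup>2 * (hnorm H x)\<^sup>2 - 2 * N\<^sup>2 * (hnorm H (P x))\<^sup>2 + (hnorm H (P (P x)))\<^sup>2)"
      using x P[OF x] P[OF P[OF x]]
      by (simp add: ip_simps sym ip_self[OF x] ip_self[OF P[OF P[OF x]]] algebra_simps)
    then have "(hnorm H (complex_of_real (N\<^sup>2) \<odot> x \<ominus> P (P x)))\<^sup>2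
      = N\<^sup>2 * N\<^sup>2 * (hnorm H x)\<^sup>2 - 2 * N\<^sup>2 * (hnorm H (P x))\<^sup>2 + (hnorm H (P (P x)))\<^sup>2"
      by (subst hnorm_sq) (use x P[OF x] P[OF P[OF x]] in simp_all)
    also have "\<dots> \<le> N\<^sup>2 * (N\<^sup>2 * (hnorm H x)\<^sup>2 - (hnorm H (P x))\<^sup>2)"
      using power_mono[OF PN[OF P[OF x]], of 2] P[OF P[OF x]]
      by (simp add: power_mult_distrib algebra_simps)
    finally have 1: "(hnorm H (complex_of_real (N\<^sup>2) \<odot> x \<ominus> P (P x)))\<^sup>2
        \<le> N\<^sup>2 * (N\<^sup>2 * (hnorm H x)\<^sup>2 - (hnorm H (P x))\<^sup>2)" .
    have "(hnorm H x)\<^sup>2 \<le> (K * hnorm H (complex_of_real (N\<^sup>2) \<odot> x \<ominus> P (P x)))\<^sup>2"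
      using K(2)[OF x] x unfolding qx by (intro power_mono) simp_all
    also have "\<dots> \<le> K\<^sup>2 * (N\<^sup>2 * (N\<^sup>2 * (hnorm H x)\<^sup>2 - (hnorm H (P x))\<^sup>2))"
      using 1 by (simp add: power_mult_distrib mult_left_mono)
    finally show ?thesis
      using K(1) N c by (simp add: m_def field_simps)
  qed
  have mN: "m < N\<^sup>2"
    using K(1) N c by (simp add: m_def)
  \<comment> \<open>The maximum with \<open>0\<close> covers the case \<open>m < 0\<close>, in which the space is zero.\<close>
  have "N \<le> sqrt (max m 0)"
    unfolding N_def
  proof (rule op_norm_le)
    fix x assume x: "x \<in> carrier H"
    have "(hnorm H (P x))\<^sup>2 \<le> max m 0 * (hnorm H x)\<^sup>2"
      by (rule order_trans[OF Pm[OF x]]) (simp add: mult_right_mono)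
    then have "(hnorm H (P x))\<^sup>2 \<le> (sqrt (max m 0) * hnorm H x)\<^sup>2"
      by (simp add: power_mult_distrib)
    then have "hnorm H (P x) \<le> sqrt (max m 0) * hnorm H x"
      by (rule power2_le_imp_le) (use x in simp)
    then show "hnorm H (op_poly H p A x) \<le> sqrt (max m 0) * hnorm H x"
      unfolding op_poly_eq_cpoly_op[OF bA x] P_def .
  qed simp
  then have "N\<^sup>2 \<le> (sqrt (max m 0))\<^sup>2"
    using N c by (intro power_mono) simp_all
  then have "N\<^sup>2 \<le> max m 0"
    by simp
  then show False
    using mN N c by (auto simp: max_def split: if_splits)
qed

text \<open>If the spectrum were empty, the previous lemma would apply with the bound \<open>0\<close> to each
  polynomial \<open>X + s\<close>, and \<open>A + s\<close> would vanish for all \<open>s\<close>.\<close>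

lemma spectrum_nonempty:
  assumes A: "form_between H a b A" and x: "x \<in> carrier H" "x \<noteq> \<zero>"
  shows "\<exists>t. complex_of_real t \<in> spectrum H A"
proof (rule ccontr)
  assume empty: "\<nexists>t. complex_of_real t \<in> spectrum H A"
  note bA = form_betweenD(1)[OF A]
  have vanish: "complex_of_real s \<odot> x \<oplus> A x = \<zero>" for s
  proof -
    let ?p = "[:s, 1:]"
    have "op_norm H (op_poly H ?p A) \<le> 0"
      by (rule op_norm_op_poly_le_if_noncst[OF A order_refl]) (use empty in auto)
    then have "hnorm H (op_poly H ?p A x) \<le> 0"
      using hnorm_le_op_norm[OF bounded_op_op_poly[OF bA] x(1), of ?p] mult_right_mono[of _ 0 "hnorm H x"] x(1)
      by fastforce
    then have "hnorm H (op_poly H ?p A x) = 0"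
      using hnorm_nonneg[OF bounded_op_closed[OF bounded_op_op_poly[OF bA] x(1)], of ?p] by linarith
    then have "op_poly H ?p A x = \<zero>"
      using hnorm_eq_0[OF bounded_op_closed[OF bounded_op_op_poly[OF bA] x(1)]] by blast
    then show ?thesis
      using x(1) by (simp add: op_poly_eq_cpoly_op[OF bA] map_poly_pCons cpoly_op_pCons[OF bA]
          bounded_op_zero[OF bA] bounded_op_scale[OF bA] bounded_op_closed[OF bA]
          smult_one[unfolded complex_ring_def, simplified])
  qed
  have "ip H x x = ip H (complex_of_real 1 \<odot> x \<oplus> A x) x - ip H (complex_of_real 0 \<odot> x \<oplus> A x) x"
    using x(1) bounded_op_closed[OF bA x(1)] by (simp add: ip_add_left ip_smult_left del: of_real_1)
  also have "\<dots> = 0"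
    unfolding vanish by simp
  finally show False
    using ip_pos[OF x] by simp
qed

text \<open>This estimate makes the functional calculus continuous: polynomials that are uniformly
  close on the spectrum give operators that are close in norm.\<close>

lemma hnorm_op_poly_le:
  assumes A: "form_between H a b A" and c: "0 \<le> c"
    and spec: "\<And>t. complex_of_real t \<in> spectrum H A \<Longrightarrow> \<bar>poly p t\<bar> \<le> c"
    and x: "x \<in> carrier H"
  shows "hnorm H (op_poly H p A x) \<le> c * hnorm H x"
proof (cases "x = \<zero>")
  case True
  then show ?thesis
    using bounded_op_zero[OF bounded_op_op_poly[OF form_betweenD(1)[OF A]]] by simp
next
  case False
  let ?N = "op_norm H (op_poly H p A)"
  have "?N \<le> c"
  proof (cases "[:?N\<^sup>2:] - p * p = 0")
    case True
    obtain t where t: "complex_of_real t \<in> spectrum H A"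
      using spectrum_nonempty[OF A x False] by blast
    have "poly ([:?N\<^sup>2:] - p * p) t = 0"
      using True by simp
    then have "?N\<^sup>2 = (poly p t)\<^sup>2"
      by (simp add: power2_eq_square)
    then have "\<bar>?N\<bar> = \<bar>poly p t\<bar>"
      by (simp add: power2_eq_iff abs_eq_iff)
    then show ?thesis
      using spec[OF t] by linarith
  qed (rule op_norm_op_poly_le_if_noncst[OF A c spec])
  then show ?thesis
    using hnorm_le_op_norm[OF bounded_op_op_poly[OF form_betweenD(1)[OF A]] x, of p] x
      mult_right_mono[of ?N c "hnorm H x"] by simp
qed

end

section \<open>The continuous functional calculus\<close>

context complex_hilbert begin

lemma ip_tendsto:
  assumes u: "\<And>n. u n \<in> carrier H" and l: "l \<in> carrier H" and z: "z \<in> carrier H"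
    and lim: "(\<lambda>n. hnorm H (u n \<ominus> l)) \<longlonglongrightarrow> 0"
  shows "(\<lambda>n. ip H (u n) z) \<longlonglongrightarrow> ip H l z"
proof (rule Lim_transform_bound[THEN Lim_null[THEN iffD2], rotated])
  show "(\<lambda>n. hnorm H (u n \<ominus> l) * hnorm H z) \<longlonglongrightarrow> 0"
    using tendsto_mult_right[OF lim, of "hnorm H z"] by simp
  have "norm (ip H (u n) z - ip H l z) \<le> norm (hnorm H (u n \<ominus> l) * hnorm H z)" for n
    using cauchy_schwarz[of "u n \<ominus> l" z] u l z by (simp add: ip_diff_left)
  then show "\<forall>\<^sub>F n in sequentially. norm (ip H (u n) z - ip H l z) \<le> norm (hnorm H (u n \<ominus> l) * hnorm H z)"
    by simp
qed

text \<open>Completeness of the bounded operators in the operator norm. The convergence is stated by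
  pointwise estimates that are uniform on the unit ball.\<close>

lemma bounded_op_limit:
  fixes S :: "nat \<Rightarrow> 'a \<Rightarrow> 'a"
  assumes S: "\<And>n. bounded_op H (S n)"
    and cauchy: "\<And>e. e > 0 \<Longrightarrow> \<exists>N. \<forall>m\<ge>N. \<forall>n\<ge>N. \<forall>x\<in>carrier H.
      hnorm H (S m x \<ominus> S n x) \<le> e * hnorm H x"
  shows "\<exists>T. bounded_op H T \<and>
    (\<forall>e>0. \<exists>N. \<forall>n\<ge>N. \<forall>x\<in>carrier H. hnorm H (S n x \<ominus> T x) \<le> e * hnorm H x)"
proof -
  note cl = bounded_op_closed[OF S]
  have ex: "\<exists>l\<in>carrier H. (\<lambda>n. hnorm H (S n x \<ominus> l)) \<longlonglongrightarrow> 0" if x: "x \<in> carrier H" for x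
  proof -
    have "\<exists>N. \<forall>m\<ge>N. \<forall>n\<ge>N. hnorm H (S m x \<ominus> S n x) < e" if "e > 0" for e
    proof -
      define k where "k = hnorm H x + 1"
      have k: "k > 0" "hnorm H x < k"
        using hnorm_nonneg[OF x] by (simp_all add: k_def)
      have pos: "e / k > 0"
        using k(1) \<open>e > 0\<close> by simp
      have "e / k * hnorm H x < e"
        using k \<open>e > 0\<close> by (simp add: pos_divide_less_eq)
      then show ?thesis
        using cauchy[OF pos] x by (meson order_le_less_trans)
    qed
    moreover have "range (\<lambda>n. S n x) \<subseteq> carrier H"
      using cl[OF x] by blast
    ultimately show ?thesis
      using complete unfolding mcomplete_iff by blast
  qed
  define T where "T = (\<lambda>x\<in>carrier H. SOME l. l \<in> carrier H \<and> (\<lambda>n. hnorm H (S n x \<ominus> l)) \<longlonglongrightarrow> 0)"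
  have T: "T x \<in> carrier H \<and> (\<lambda>n. hnorm H (S n x \<ominus> T x)) \<longlonglongrightarrow> 0" if x: "x \<in> carrier H" for x
    using someI_ex[of "\<lambda>l. l \<in> carrier H \<and> (\<lambda>n. hnorm H (S n x \<ominus> l)) \<longlonglongrightarrow> 0"] ex[OF x] x
    unfolding T_def by auto
  then have Tcl: "T x \<in> carrier H" if "x \<in> carrier H" for x
    using that by blast
  have Tlim: "(\<lambda>n. ip H (S n x) z) \<longlonglongrightarrow> ip H (T x) z" if "x \<in> carrier H" "z \<in> carrier H" for x z
    using T[OF that(1)] cl[OF that(1)] that(2) by (intro ip_tendsto) auto
  have unif: "\<exists>N. \<forall>n\<ge>N. \<forall>x\<in>carrier H. hnorm H (S n x \<ominus> T x) \<le> e * hnorm H x" if "e > 0" for e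
  proof -
    obtain N where N: "\<And>m n x. \<lbrakk>m \<ge> N; n \<ge> N; x \<in> carrier H\<rbrakk> \<Longrightarrow> hnorm H (S m x \<ominus> S n x) \<le> e * hnorm H x"
      using cauchy[OF \<open>e > 0\<close>] by blast
    have "hnorm H (S n x \<ominus> T x) \<le> e * hnorm H x" if n: "n \<ge> N" and x: "x \<in> carrier H" for n x
    proof (rule LIMSEQ_le_const)
      show "(\<lambda>m. e * hnorm H x + hnorm H (S m x \<ominus> T x)) \<longlonglongrightarrow> e * hnorm H x"
        using tendsto_add[OF tendsto_const conjunct2[OF T[OF x]]] by simp
      have "hnorm H (S n x \<ominus> T x) \<le> e * hnorm H x + hnorm H (S m x \<ominus> T x)" if "m \<ge> N" for m
        using hnorm_diff_triangle[OF cl[OF x, of n] cl[OF x, of m] Tcl[OF x]] N[OF n that x] by linarith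
      then show "\<exists>N. \<forall>m\<ge>N. hnorm H (S n x \<ominus> T x) \<le> e * hnorm H x + hnorm H (S m x \<ominus> T x)"
        by blast
    qed
    then show ?thesis by blast
  qed
  obtain N where N: "\<And>x. x \<in> carrier H \<Longrightarrow> hnorm H (S N x \<ominus> T x) \<le> 1 * hnorm H x"
    using unif[of 1] by auto
  obtain K where K: "\<And>x. x \<in> carrier H \<Longrightarrow> hnorm H (S N x) \<le> K * hnorm H x"
    using bounded_op_bound[OF S[of N]] by blast
  have "bounded_op H T"
  proof (rule bounded_opI[where K = "K + 1"])
    show "T x \<in> carrier H" if "x \<in> carrier H" for x
      using Tcl[OF that] .
    show "T (x \<oplus> y) = T x \<oplus> T y" if x: "x \<in> carrier H" and y: "y \<in> carrier H" for x y
    proof (rule vec_eqI)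
      fix z assume z: "z \<in> carrier H"
      have "(\<lambda>n. ip H (S n (x \<oplus> y)) z) = (\<lambda>n. ip H (S n x) z + ip H (S n y) z)"
        using bounded_op_add[OF S x y] ip_add_left[OF cl[OF x] cl[OF y] z] by simp
      then have "(\<lambda>n. ip H (S n (x \<oplus> y)) z) \<longlonglongrightarrow> ip H (T x) z + ip H (T y) z"
        using tendsto_add[OF Tlim[OF x z] Tlim[OF y z]] by simp
      moreover have "(\<lambda>n. ip H (S n (x \<oplus> y)) z) \<longlonglongrightarrow> ip H (T (x \<oplus> y)) z"
        by (rule Tlim) (use x y z in auto)
      ultimately show "ip H (T (x \<oplus> y)) z = ip H (T x \<oplus> T y) z"
        using LIMSEQ_unique ip_add_left[OF Tcl[OF x] Tcl[OF y] z] by metis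
    qed (use x y Tcl in auto)
    show "T (c \<odot> x) = c \<odot> T x" if x: "x \<in> carrier H" for c x
    proof (rule vec_eqI)
      fix z assume z: "z \<in> carrier H"
      have "(\<lambda>n. ip H (S n (c \<odot> x)) z) = (\<lambda>n. c * ip H (S n x) z)"
        using bounded_op_scale[OF S x] ip_smult_left[OF cl[OF x] z] by simp
      then have "(\<lambda>n. ip H (S n (c \<odot> x)) z) \<longlonglongrightarrow> c * ip H (T x) z"
        using tendsto_mult_left[OF Tlim[OF x z]] by simp
      moreover have "(\<lambda>n. ip H (S n (c \<odot> x)) z) \<longlonglongrightarrow> ip H (T (c \<odot> x)) z"
        by (rule Tlim) (use x z in auto)
      ultimately show "ip H (T (c \<odot> x)) z = ip H (c \<odot> T x) z"
        using LIMSEQ_unique ip_smult_left[OF Tcl[OF x] z] by metis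
    qed (use x Tcl in auto)
    show "hnorm H (T x) \<le> (K + 1) * hnorm H x" if x: "x \<in> carrier H" for x
    proof -
      have "T x = S N x \<ominus> (S N x \<ominus> T x)"
        using cl[OF x] Tcl[OF x] by (intro vec_eqI) (simp_all add: ip_simps)
      also have "hnorm H \<dots> \<le> hnorm H (S N x) + hnorm H (S N x \<ominus> T x)"
        using hnorm_triangle[of "S N x" "(-1) \<odot> (S N x \<ominus> T x)"] cl[OF x] Tcl[OF x]
        by (simp add: diff_conv_add_scale[of "S N x" "S N x \<ominus> T x"] hnorm_scale)
      finally show ?thesis
        using K[OF x] N[OF x] by (simp add: distrib_right)
    qed
  qed (simp add: T_def)
  then show ?thesis
    using unif by blast
qed

end

lemma weierstrass_poly_sequence:
  fixes g :: "real \<Rightarrow> real"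
  assumes "continuous_on {a..b} g"
  obtains p :: "nat \<Rightarrow> real poly" where "uniform_limit {a..b} (\<lambda>n. poly (p n)) g sequentially"
proof -
  have "\<exists>q. \<forall>t\<in>{a..b}. \<bar>g t - poly q t\<bar> < 1 / real (Suc n)" for n
  proof -
    obtain h where h: "real_polynomial_function h" "\<And>t. t \<in> {a..b} \<Longrightarrow> \<bar>g t - h t\<bar> < 1 / real (Suc n)"
      using Stone_Weierstrass_real_polynomial_function[OF _ assms, of "1 / real (Suc n)"] by auto
    obtain c d where "h = (\<lambda>t. \<Sum>i\<le>d. c i * t ^ i)"
      using h(1) unfolding real_polynomial_function_iff_sum by blast
    then have "h = poly (\<Sum>i\<le>d. monom (c i) i)"
      by (simp add: fun_eq_iff poly_sum poly_monom)
    then show ?thesis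
      using h(2) by blast
  qed
  then obtain p where p: "\<And>n t. t \<in> {a..b} \<Longrightarrow> \<bar>g t - poly (p n) t\<bar> < 1 / real (Suc n)"
    by metis
  have "uniform_limit {a..b} (\<lambda>n. poly (p n)) g sequentially"
  proof (rule uniform_limitI)
    fix e :: real
    assume "e > 0"
    then obtain N where N: "inverse (real (Suc N)) < e"
      using reals_Archimedean by blast
    have "\<forall>t\<in>{a..b}. dist (poly (p n) t) (g t) < e" if "n \<ge> N" for n
    proof
      fix t assume "t \<in> {a..b}"
      then have "dist (poly (p n) t) (g t) < 1 / real (Suc n)"
        using p[of t n] by (simp add: dist_real_def abs_minus_commute)
      also have "\<dots> \<le> inverse (real (Suc N))"
        using that by (simp add: field_simps)
      finally show "dist (poly (p n) t) (g t) < e"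
        using N by simp
    qed
    then show "\<forall>\<^sub>F n in sequentially. \<forall>t\<in>{a..b}. dist (poly (p n) t) (g t) < e"
      unfolding eventually_sequentially by blast
  qed
  then show thesis
    by (rule that)
qed

context complex_hilbert begin

text \<open>Polynomials that converge to \<open>g\<close> on \<open>[a, b]\<close> give a Cauchy sequence of operators. Its
  limit \<open>T\<close> satisfies the condition in the definition of \<open>cfc\<close>, since any other sequence of
  polynomials with the limit \<open>g\<close> on the spectrum is uniformly close to the first one there. It
  is the only such operator, since the first sequence has one limit.\<close>

lemma cfc_spec:
  assumes A: "form_between H a b A" and g: "continuous_on {a..b} g"
  shows "bounded_op H (cfc H g A) \<and>
    (\<forall>p. uniform_limit {a..b} (\<lambda>n. poly (p n)) g sequentially
      \<longrightarrow> (\<forall>x\<in>carrier H. (\<lambda>n. hnorm H (op_poly H (p n) A x \<ominus> cfc H g A x)) \<longlonglongrightarrow> 0))"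
proof -
  define Z where "Z = {t. complex_of_real t \<in> spectrum H A}"
  have Z: "Z \<subseteq> {a..b}"
    using spectrum_form_between[OF A] by (auto simp: Z_def)
  note bA = form_betweenD(1)[OF A]
  note bp = bounded_op_op_poly[OF bA]
  note cl = bounded_op_closed[OF bp]
  have close: "hnorm H (op_poly H r A x \<ominus> op_poly H q A x) \<le> e * hnorm H x"
    if "0 \<le> e" "\<And>t. t \<in> Z \<Longrightarrow> \<bar>poly r t - poly q t\<bar> \<le> e" "x \<in> carrier H" for r q e x
  proof -
    have "op_poly H r A x \<ominus> op_poly H q A x = op_poly H (r - q) A x"
      using that(3) by (simp add: op_poly_eq_cpoly_op[OF bA] map_poly_of_real_diff cpoly_op_diff[OF bA])
    then show ?thesis
      using hnorm_op_poly_le[OF A that(1), of "r - q" x] that by (simp add: Z_def)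
  qed
  obtain p where p: "uniform_limit {a..b} (\<lambda>n. poly (p n)) g sequentially"
    using weierstrass_poly_sequence[OF g] .
  have pZ: "\<exists>N. \<forall>n\<ge>N. \<forall>t\<in>Z. \<bar>poly (p n) t - g t\<bar> < e" if "e > 0" for e
    using uniform_limitD[OF uniform_limit_on_subset[OF p Z] that]
    by (simp add: eventually_sequentially dist_real_def)
  have "\<exists>T. bounded_op H T \<and>
    (\<forall>e>0. \<exists>N. \<forall>n\<ge>N. \<forall>x\<in>carrier H. hnorm H (op_poly H (p n) A x \<ominus> T x) \<le> e * hnorm H x)"
  proof (rule bounded_op_limit[OF bp])
    fix e :: real assume "e > 0"
    then obtain N where N: "\<And>n t. \<lbrakk>n \<ge> N; t \<in> Z\<rbrakk> \<Longrightarrow> \<bar>poly (p n) t - g t\<bar> < e / 2"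
      using pZ[of "e / 2"] by auto
    have "hnorm H (op_poly H (p m) A x \<ominus> op_poly H (p n) A x) \<le> e * hnorm H x"
      if "m \<ge> N" "n \<ge> N" "x \<in> carrier H" for m n x
    proof (rule close)
      show "\<bar>poly (p m) t - poly (p n) t\<bar> \<le> e" if "t \<in> Z" for t
        using N[OF \<open>m \<ge> N\<close> that] N[OF \<open>n \<ge> N\<close> that] by linarith
    qed (use \<open>e > 0\<close> that in simp_all)
    then show "\<exists>N. \<forall>m\<ge>N. \<forall>n\<ge>N. \<forall>x\<in>carrier H.
        hnorm H (op_poly H (p m) A x \<ominus> op_poly H (p n) A x) \<le> e * hnorm H x"
      by blast
  qed
  then obtain T where T: "bounded_op H T"
    and lim: "\<And>e. e > 0 \<Longrightarrow> \<exists>N. \<forall>n\<ge>N. \<forall>x\<in>carrier H. hnorm H (op_poly H (p n) A x \<ominus> T x) \<le> e * hnorm H x"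
    by blast
  note Tcl = bounded_op_closed[OF T]
  have unif: "\<exists>N. \<forall>n\<ge>N. \<forall>x\<in>carrier H. hnorm H (op_poly H (q n) A x \<ominus> T x) \<le> e * hnorm H x"
    if q: "uniform_limit Z (\<lambda>n. poly (q n)) g sequentially" and "e > 0" for q e
  proof -
    obtain N1 where N1: "\<And>n x. \<lbrakk>n \<ge> N1; x \<in> carrier H\<rbrakk> \<Longrightarrow> hnorm H (op_poly H (p n) A x \<ominus> T x) \<le> e / 2 * hnorm H x"
      using lim[of "e / 2"] \<open>e > 0\<close> by auto
    obtain N2 where N2: "\<And>n t. \<lbrakk>n \<ge> N2; t \<in> Z\<rbrakk> \<Longrightarrow> \<bar>poly (p n) t - g t\<bar> < e / 4"
      using pZ[of "e / 4"] \<open>e > 0\<close> by auto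
    obtain N3 where N3: "\<And>n t. \<lbrakk>n \<ge> N3; t \<in> Z\<rbrakk> \<Longrightarrow> \<bar>poly (q n) t - g t\<bar> < e / 4"
      using uniform_limitD[OF q, of "e / 4"] \<open>e > 0\<close>
      by (auto simp: eventually_sequentially dist_real_def)
    have "hnorm H (op_poly H (q n) A x \<ominus> T x) \<le> e * hnorm H x"
      if n: "n \<ge> max N1 (max N2 N3)" and x: "x \<in> carrier H" for n x
    proof -
      have "hnorm H (op_poly H (q n) A x \<ominus> op_poly H (p n) A x) \<le> e / 2 * hnorm H x"
      proof (rule close)
        show "\<bar>poly (q n) t - poly (p n) t\<bar> \<le> e / 2" if "t \<in> Z" for t
        proof -
          have "\<bar>poly (p n) t - g t\<bar> < e / 4" "\<bar>poly (q n) t - g t\<bar> < e / 4"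
            using n that by (intro N2 N3; simp)+
          then show ?thesis
            by linarith
        qed
      qed (use \<open>e > 0\<close> x in simp_all)
      then show ?thesis
        using hnorm_diff_triangle[OF cl[OF x, of "q n"] cl[OF x, of "p n"] Tcl[OF x]] N1[of n x] n x
        by simp
    qed
    then show ?thesis by blast
  qed
  have "cfc H g A = T"
    unfolding cfc_def Z_def[symmetric]
  proof (rule the_equality)
    show "bounded_op H T \<and> (\<forall>p. uniform_limit Z (\<lambda>n. poly (p n)) g sequentially
        \<longrightarrow> (\<lambda>n. op_norm H (op_diff H (op_poly H (p n) A) T)) \<longlonglongrightarrow> 0)"
    proof (intro conjI allI impI T)
      fix q assume q: "uniform_limit Z (\<lambda>n. poly (q n)) g sequentially"
      show "(\<lambda>n. op_norm H (op_diff H (op_poly H (q n) A) T)) \<longlonglongrightarrow> 0"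
      proof (rule LIMSEQ_I)
        fix e :: real assume "e > 0"
        then obtain N where N: "\<And>n x. \<lbrakk>n \<ge> N; x \<in> carrier H\<rbrakk> \<Longrightarrow>
            hnorm H (op_diff H (op_poly H (q n) A) T x) \<le> e / 2 * hnorm H x"
          using unif[OF q, of "e / 2"] by (auto simp: op_diff_def)
        have "norm (op_norm H (op_diff H (op_poly H (q n) A) T) - 0) < e" if "n \<ge> N" for n
        proof -
          have "op_norm H (op_diff H (op_poly H (q n) A) T) \<le> e / 2"
            using \<open>e > 0\<close> N[OF that] by (intro op_norm_le) simp_all
          moreover have "0 \<le> op_norm H (op_diff H (op_poly H (q n) A) T)"
            by (rule op_norm_nonneg[OF N[OF that]])
              (use cl Tcl in \<open>simp_all add: op_diff_def\<close>)
          ultimately show ?thesis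
            using \<open>e > 0\<close> by simp
        qed
        then show "\<exists>N. \<forall>n\<ge>N. norm (op_norm H (op_diff H (op_poly H (q n) A) T) - 0) < e"
          by blast
      qed
    qed
    fix T' assume "bounded_op H T' \<and> (\<forall>p. uniform_limit Z (\<lambda>n. poly (p n)) g sequentially
        \<longrightarrow> (\<lambda>n. op_norm H (op_diff H (op_poly H (p n) A) T')) \<longlonglongrightarrow> 0)"
    then have T': "bounded_op H T'"
      and lim': "(\<lambda>n. op_norm H (op_diff H (op_poly H (p n) A) T')) \<longlonglongrightarrow> 0"
      using uniform_limit_on_subset[OF p Z] by blast+
    show "T' = T"
    proof (rule extensionalityI[OF bounded_op_extensional[OF T'] bounded_op_extensional[OF T]])
      fix x assume x: "x \<in> carrier H"
      note T'cl = bounded_op_closed[OF T']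
      have "hnorm H (T' x \<ominus> T x) \<le> e" if "e > 0" for e
      proof -
        define k where "k = hnorm H x + 1"
        have k: "k > 0" "hnorm H x \<le> k"
          using hnorm_nonneg[OF x] by (simp_all add: k_def)
        obtain N1 where N1: "\<And>n. n \<ge> N1 \<Longrightarrow> hnorm H (op_poly H (p n) A x \<ominus> T x) \<le> e / (2 * k) * hnorm H x"
          using lim[of "e / (2 * k)"] \<open>e > 0\<close> k x by auto
        obtain N2 where N2: "\<And>n. n \<ge> N2 \<Longrightarrow> \<bar>op_norm H (op_diff H (op_poly H (p n) A) T')\<bar> < e / (2 * k)"
          using LIMSEQ_D[OF lim', of "e / (2 * k)"] \<open>e > 0\<close> k by auto
        define n where "n = max N1 N2"
        have "hnorm H (op_diff H (op_poly H (p n) A) T' x)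
            \<le> op_norm H (op_diff H (op_poly H (p n) A) T') * hnorm H x"
          by (rule hnorm_op_diff_le[OF bp T' x])
        also have "\<dots> \<le> e / (2 * k) * hnorm H x"
          using N2[of n] x by (intro mult_right_mono) (simp_all add: n_def)
        finally have "hnorm H (T' x \<ominus> op_poly H (p n) A x) \<le> e / (2 * k) * hnorm H x"
          using x hnorm_diff_commute[OF T'cl[OF x] cl[OF x]] by (simp add: op_diff_def)
        then have "hnorm H (T' x \<ominus> T x) \<le> 2 * (e / (2 * k) * hnorm H x)"
          using hnorm_diff_triangle[OF T'cl[OF x] cl[OF x, of "p n"] Tcl[OF x]]
            N1[of n, unfolded n_def, OF max.cobounded1, folded n_def]
          by linarith
        also have "\<dots> \<le> e"
          using k \<open>e > 0\<close> by (simp add: pos_divide_less_eq pos_divide_le_eq)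
        finally show ?thesis .
      qed
      then have "hnorm H (T' x \<ominus> T x) \<le> 0"
        by (rule_tac field_le_epsilon) simp
      then have "hnorm H (T' x \<ominus> T x) = 0"
        using hnorm_nonneg[OF M.minus_closed[OF T'cl[OF x] Tcl[OF x]]] by linarith
      then show "T' x = T x"
        using hnorm_diff_eq_0[OF T'cl[OF x] Tcl[OF x]] by simp
    qed
  qed
  moreover have "(\<lambda>n. hnorm H (op_poly H (q n) A x \<ominus> T x)) \<longlonglongrightarrow> 0"
    if q: "uniform_limit {a..b} (\<lambda>n. poly (q n)) g sequentially" and x: "x \<in> carrier H" for q x
  proof (rule LIMSEQ_I)
    fix e :: real assume "e > 0"
    define k where "k = hnorm H x + 1"
    have k: "k > 0" "hnorm H x < k"
      using hnorm_nonneg[OF x] by (simp_all add: k_def)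
    obtain N where N: "\<And>n. n \<ge> N \<Longrightarrow> hnorm H (op_poly H (q n) A x \<ominus> T x) \<le> e / k * hnorm H x"
      using unif[OF uniform_limit_on_subset[OF q Z], of "e / k"] \<open>e > 0\<close> k x by auto
    have "e / k * hnorm H x < e"
      using k \<open>e > 0\<close> by (simp add: pos_divide_less_eq pos_divide_le_eq)
    then have "norm (hnorm H (op_poly H (q n) A x \<ominus> T x) - 0) < e" if "n \<ge> N" for n
      using N[OF that] cl[OF x] Tcl[OF x] by simp
    then show "\<exists>N. \<forall>n\<ge>N. norm (hnorm H (op_poly H (q n) A x \<ominus> T x) - 0) < e"
      by blast
  qed
  ultimately show ?thesis
    using T by auto
qed

lemma bounded_op_cfc:
  "\<lbrakk>form_between H a b A; continuous_on {a..b} g\<rbrakk> \<Longrightarrow> bounded_op H (cfc H g A)"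
  using cfc_spec by blast

lemma ip_cfc_tendsto:
  assumes A: "form_between H a b A" and g: "continuous_on {a..b} g"
    and p: "uniform_limit {a..b} (\<lambda>n. poly (p n)) g sequentially"
    and x: "x \<in> carrier H" and z: "z \<in> carrier H"
  shows "(\<lambda>n. ip H (op_poly H (p n) A x) z) \<longlonglongrightarrow> ip H (cfc H g A x) z"
proof (rule ip_tendsto)
  show "op_poly H (p n) A x \<in> carrier H" for n
    using bounded_op_closed[OF bounded_op_op_poly[OF form_betweenD(1)[OF A]] x] .
  show "cfc H g A x \<in> carrier H"
    using bounded_op_closed[OF bounded_op_cfc[OF A g] x] .
  show "(\<lambda>n. hnorm H (op_poly H (p n) A x \<ominus> cfc H g A x)) \<longlonglongrightarrow> 0"
    using cfc_spec[OF A g] p x by blast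
qed (rule z)

end

lemma op_poly_intertwining:
  assumes "inner_product_space H" "inner_product_space K"
    and A: "bounded_op H A" and C: "bounded_op K C"
    and J: "\<And>x. x \<in> carrier H \<Longrightarrow> J x \<in> carrier K"
    and J_add: "\<And>x y. \<lbrakk>x \<in> carrier H; y \<in> carrier H\<rbrakk> \<Longrightarrow> J (x \<oplus>\<^bsub>H\<^esub> y) = J x \<oplus>\<^bsub>K\<^esub> J y"
    and J_scale: "\<And>c x. x \<in> carrier H \<Longrightarrow> J (c \<odot>\<^bsub>H\<^esub> x) = c \<odot>\<^bsub>K\<^esub> J x"
    and JA: "\<And>x. x \<in> carrier H \<Longrightarrow> J (A x) = C (J x)"
    and x: "x \<in> carrier H"
  shows "J (op_poly H p A x) = op_poly K p C (J x)"
proof -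
  interpret H: inner_product_space H by fact
  interpret K: inner_product_space K by fact
  have J0: "J \<zero>\<^bsub>H\<^esub> = \<zero>\<^bsub>K\<^esub>"
    using J_scale[of "\<zero>\<^bsub>H\<^esub>" 0] J[of "\<zero>\<^bsub>H\<^esub>"] by simp
  have "J (H.cpoly_op A q x) = K.cpoly_op C q (J x)" for q
    using x
    by (induction q) (simp_all add: J0 H.cpoly_op_pCons[OF A] K.cpoly_op_pCons[OF C] J_add J_scale JA J
        H.cpoly_op_closed[OF A] H.bounded_op_closed[OF A])
  then show ?thesis
    using x J by (simp add: H.op_poly_eq_cpoly_op[OF A] K.op_poly_eq_cpoly_op[OF C])
qed

text \<open>If \<open>J\<close> intertwines \<open>A\<close> and \<open>C\<close>, it intertwines \<open>p(A)\<close> and \<open>p(C)\<close> for every polynomial \<open>p\<close>,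
  and one sequence of polynomials approximates \<open>g\<close> for both operators. Passing to the limit in
  the inner products makes it unnecessary to relate the operators \<open>g(A)\<close> and \<open>g(C)\<close> themselves.\<close>

lemma cfc_intertwining:
  assumes H: "complex_hilbert H" and K: "complex_hilbert K"
    and A: "form_between H a b A" and C: "form_between K a b C"
    and g: "continuous_on {a..b} g"
    and J: "\<And>x. x \<in> carrier H \<Longrightarrow> J x \<in> carrier K"
    and J_add: "\<And>x y. \<lbrakk>x \<in> carrier H; y \<in> carrier H\<rbrakk> \<Longrightarrow> J (x \<oplus>\<^bsub>H\<^esub> y) = J x \<oplus>\<^bsub>K\<^esub> J y"
    and J_scale: "\<And>c x. x \<in> carrier H \<Longrightarrow> J (c \<odot>\<^bsub>H\<^esub> x) = c \<odot>\<^bsub>K\<^esub> J x"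
    and J_ip: "\<And>x y. \<lbrakk>x \<in> carrier H; y \<in> carrier H\<rbrakk> \<Longrightarrow> ip K (J x) (J y) = c * ip H x y"
    and JA: "\<And>x. x \<in> carrier H \<Longrightarrow> J (A x) = C (J x)"
    and x: "x \<in> carrier H"
  shows "ip K (cfc K g C (J x)) (J x) = c * ip H (cfc H g A x) x"
proof -
  interpret H: complex_hilbert H by fact
  interpret K: complex_hilbert K by fact
  obtain p where p: "uniform_limit {a..b} (\<lambda>n. poly (p n)) g sequentially"
    using weierstrass_poly_sequence[OF g] .
  note bA = H.form_betweenD(1)[OF A] and bC = K.form_betweenD(1)[OF C]
  have "ip K (op_poly K q C (J x)) (J x) = c * ip H (op_poly H q A x) x" for q
    using op_poly_intertwining[OF H.inner_product_space_axioms K.inner_product_space_axioms bA bC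
        J J_add J_scale JA x, of q, symmetric]
      J_ip[OF H.bounded_op_closed[OF H.bounded_op_op_poly[OF bA] x] x] by simp
  then have "(\<lambda>n. c * ip H (op_poly H (p n) A x) x) \<longlonglongrightarrow> ip K (cfc K g C (J x)) (J x)"
    using K.ip_cfc_tendsto[OF C g p J[OF x] J[OF x]] by simp
  then show ?thesis
    using tendsto_mult_left[OF H.ip_cfc_tendsto[OF A g p x x]] LIMSEQ_unique by blast
qed

section \<open>Compression to the range of a projection\<close>

lemma (in inner_product_space) inner_product_space_subspace:
  assumes V: "V \<subseteq> carrier H" "\<zero> \<in> V"
    and add: "\<And>x y. \<lbrakk>x \<in> V; y \<in> V\<rbrakk> \<Longrightarrow> x \<oplus> y \<in> V"
    and scale: "\<And>c x. x \<in> V \<Longrightarrow> c \<odot> x \<in> V"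
  shows "inner_product_space (H\<lparr>carrier := V\<rparr>)" (is "inner_product_space ?R")
proof -
  have V': "x \<in> carrier H" if "x \<in> V" for x
    using V that by blast
  have "abelian_group ?R"
  proof (rule abelian_groupI)
    fix x assume x: "x \<in> carrier ?R"
    have "((-1) \<odot> x) \<oplus> x = \<zero>"
      using x V' by (intro vec_eqI) (simp_all add: ip_simps)
    then show "\<exists>y\<in>carrier ?R. y \<oplus>\<^bsub>?R\<^esub> x = \<zero>\<^bsub>?R\<^esub>"
      using x scale[of x "-1"] by (intro bexI[of _ "(-1) \<odot> x"]) simp_all
  qed (use V V' add in \<open>simp_all add: M.a_ac\<close>)
  moreover have "(c + d) \<odot> x = c \<odot> x \<oplus> d \<odot> x" "(c * d) \<odot> x = c \<odot> (d \<odot> x)" "1 \<odot> x = x"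
    "c \<odot> (x \<oplus> y) = c \<odot> x \<oplus> c \<odot> y"
    if "x \<in> V" "y \<in> V" for c d x y
    using V'[OF that(1)] V'[OF that(2)]
    by (intro vec_eqI; simp add: ip_simps algebra_simps)+
  ultimately have "Module.module complex_ring ?R"
    using scale by (intro moduleI[OF R.is_cring]) (simp_all add: complex_ring_def)
  then show ?thesis
    by (rule inner_product_space.intro)
      (rule inner_product_space_axioms.intro;
        use V' in \<open>simp add: ip_add_left ip_smult_left ip_pos ip_cnj[symmetric]\<close>)
qed

context complex_hilbert begin

context
  fixes P
  assumes P: "orth_proj H P"
begin

lemma orth_proj_bounded_op: "bounded_op H P"
  using P by (simp add: orth_proj_def self_adjoint_def)

lemma orth_proj_closed: "x \<in> carrier H \<Longrightarrow> P x \<in> carrier H"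
  by (rule bounded_op_closed[OF orth_proj_bounded_op])

lemma ip_orth_proj: "\<lbrakk>x \<in> carrier H; y \<in> carrier H\<rbrakk> \<Longrightarrow> ip H (P x) y = ip H x (P y)"
  using P by (simp add: orth_proj_def self_adjoint_def)

lemma orth_proj_range_iff: "x \<in> P ` carrier H \<longleftrightarrow> x \<in> carrier H \<and> P x = x"
proof
  show "x \<in> P ` carrier H \<Longrightarrow> x \<in> carrier H \<and> P x = x"
    using P orth_proj_closed by (auto simp: orth_proj_def)
  show "x \<in> carrier H \<and> P x = x \<Longrightarrow> x \<in> P ` carrier H"
    by (metis imageI)
qed

lemma inner_product_space_range_space: "inner_product_space (range_space H P)"
  unfolding range_space_def
proof (rule inner_product_space_subspace)
  note bP = orth_proj_bounded_op
  show "P ` carrier H \<subseteq> carrier H"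
    using orth_proj_closed by blast
  show "\<zero> \<in> P ` carrier H"
    by (simp add: orth_proj_range_iff bounded_op_zero[OF bP])
  show "x \<oplus> y \<in> P ` carrier H" if "x \<in> P ` carrier H" "y \<in> P ` carrier H" for x y
    using that by (simp add: orth_proj_range_iff bounded_op_add[OF bP])
  show "c \<odot> x \<in> P ` carrier H" if "x \<in> P ` carrier H" for c x
    using that by (simp add: orth_proj_range_iff bounded_op_scale[OF bP])
qed

lemma hnorm_range_space: "hnorm (range_space H P) x = hnorm H x"
  by (simp add: hnorm_def range_space_def)

text \<open>The additive inverse in a structure is chosen from the carrier of that structure, so
  subtraction in a subspace has to be compared with subtraction in the whole space.\<close>

lemma range_space_diff:
  assumes "x \<in> P ` carrier H" "y \<in> P ` carrier H"
  shows "x \<ominus>\<^bsub>range_space H P\<^esub> y = x \<ominus> y"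
proof -
  interpret R: inner_product_space "range_space H P"
    by (rule inner_product_space_range_space)
  have "x \<ominus>\<^bsub>range_space H P\<^esub> y = x \<oplus> (-1) \<odot> y"
    using R.diff_conv_add_scale[of x y] assms by (simp add: range_space_def)
  then show ?thesis
    using diff_conv_add_scale[of x y] assms by (simp add: orth_proj_range_iff)
qed

text \<open>The range consists of the fixed points of \<open>P\<close>, and a limit of fixed points is a fixed
  point because \<open>\<langle>P l, z\<rangle> = \<langle>l, P z\<rangle>\<close> depends continuously on \<open>l\<close>.\<close>

lemma complex_hilbert_range_space: "complex_hilbert (range_space H P)"
proof -
  let ?R = "range_space H P"
  interpret R: inner_product_space ?R
    by (rule inner_product_space_range_space)
  have "Metric_space.mcomplete (carrier ?R) (hdist ?R)"
    unfolding R.mcomplete_iff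
  proof (intro allI impI, elim conjE)
    fix s :: "nat \<Rightarrow> 'a"
    assume "range s \<subseteq> carrier ?R"
      and cauchy: "\<forall>e>0. \<exists>N. \<forall>m\<ge>N. \<forall>n\<ge>N. hnorm ?R (s m \<ominus>\<^bsub>?R\<^esub> s n) < e"
    then have s: "s n \<in> P ` carrier H" for n
      by (auto simp: range_space_def)
    have sH: "s n \<in> carrier H" "P (s n) = s n" for n
      using s[of n] by (simp_all add: orth_proj_range_iff)
    have "\<forall>e>0. \<exists>N. \<forall>m\<ge>N. \<forall>n\<ge>N. hnorm H (s m \<ominus> s n) < e"
      using cauchy by (simp add: range_space_diff[OF s s] hnorm_range_space)
    moreover have "range s \<subseteq> carrier H"
      using sH(1) by blast
    ultimately obtain l where l: "l \<in> carrier H" "(\<lambda>n. hnorm H (s n \<ominus> l)) \<longlonglongrightarrow> 0"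
      using complete unfolding mcomplete_iff by blast
    have "P l = l"
    proof (rule vec_eqI)
      fix z assume z: "z \<in> carrier H"
      have "(\<lambda>n. ip H (s n) z) \<longlonglongrightarrow> ip H l z"
        by (rule ip_tendsto) (use sH l z in auto)
      moreover have "(\<lambda>n. ip H (s n) (P z)) \<longlonglongrightarrow> ip H l (P z)"
        by (rule ip_tendsto) (use sH l z orth_proj_closed in auto)
      moreover have "ip H (s n) (P z) = ip H (s n) z" for n
        using ip_orth_proj[OF sH(1) z, of n] sH(2)[of n] by simp
      ultimately show "ip H (P l) z = ip H l z"
        using LIMSEQ_unique ip_orth_proj[OF l(1) z] by fastforce
    qed (use l orth_proj_closed in auto)
    then have lR: "l \<in> P ` carrier H"
      using l(1) by (simp add: orth_proj_range_iff)
    then show "\<exists>l\<in>carrier ?R. (\<lambda>n. hnorm ?R (s n \<ominus>\<^bsub>?R\<^esub> l)) \<longlonglongrightarrow> 0"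
      using l(2) by (intro bexI[of _ l]) (simp_all add: range_space_diff[OF s lR] hnorm_range_space,
          simp add: range_space_def)
  qed
  then show ?thesis
    by (intro complex_hilbert.intro complex_hilbert_axioms.intro R.module_axioms R.ip_add_left
        R.ip_smult_left R.ip_pos) (auto intro: R.ip_cnj)
qed

text \<open>For \<open>x\<close> in the range of \<open>P\<close> one has \<open>\<langle>P A x, x\<rangle> = \<langle>A x, P x\<rangle> = \<langle>A x, x\<rangle>\<close>, so the form of
  the compression is a restriction of the form of \<open>A\<close>.\<close>

lemma form_between_compression:
  assumes A: "form_between H a b A"
  shows "form_between (range_space H P) a b (compression H P A)"
proof -
  let ?R = "range_space H P" and ?C = "compression H P A"
  interpret R: inner_product_space ?R
    by (rule inner_product_space_range_space)
  note bP = orth_proj_bounded_op and bA = form_betweenD(1)[OF A]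
  obtain K where K: "0 < K" "\<And>x. x \<in> carrier H \<Longrightarrow> hnorm H (P x) \<le> K * hnorm H x"
    using bounded_op_bound[OF bP] by blast
  obtain L where L: "0 < L" "\<And>x. x \<in> carrier H \<Longrightarrow> hnorm H (A x) \<le> L * hnorm H x"
    using bounded_op_bound[OF bA] by blast
  have C: "?C x = P (A x)" if "x \<in> P ` carrier H" for x
    using that by (simp add: compression_def)
  have mem: "x \<in> carrier H" "P x = x" "A x \<in> carrier H" "x \<in> P ` carrier H" if "x \<in> carrier ?R" for x
    using that bounded_op_closed[OF bA, of x] by (auto simp: range_space_def orth_proj_range_iff)
  have ops: "x \<oplus>\<^bsub>?R\<^esub> y = x \<oplus> y" "c \<odot>\<^bsub>?R\<^esub> x = c \<odot> x" "ip ?R x y = ip H x y" for x y c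
    by (simp_all add: range_space_def)
  have "bounded_op ?R ?C"
  proof (rule R.bounded_opI[where K = "K * L"])
    show "?C \<in> extensional (carrier ?R)"
      by (simp add: compression_def range_space_def)
    show "?C x \<in> carrier ?R" if x: "x \<in> carrier ?R" for x
      using mem[OF x] by (simp add: C range_space_def)
    show "?C (x \<oplus>\<^bsub>?R\<^esub> y) = ?C x \<oplus>\<^bsub>?R\<^esub> ?C y" if x: "x \<in> carrier ?R" and y: "y \<in> carrier ?R" for x y
      using mem[OF x] mem[OF y] mem(4)[OF R.a_closed[OF x y]]
      by (simp add: ops C bounded_op_add[OF bA] bounded_op_add[OF bP])
    show "?C (c \<odot>\<^bsub>?R\<^esub> x) = c \<odot>\<^bsub>?R\<^esub> ?C x" if x: "x \<in> carrier ?R" for c x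
      using mem[OF x] mem(4)[OF R.scale_closed[OF x, of c]]
      by (simp add: ops C bounded_op_scale[OF bA] bounded_op_scale[OF bP])
    show "hnorm ?R (?C x) \<le> K * L * hnorm ?R x" if x: "x \<in> carrier ?R" for x
      using order_trans[OF K(2)[OF mem(3)[OF x]] mult_left_mono[OF L(2)[OF mem(1)[OF x]]]] K(1) mem[OF x]
      by (simp add: hnorm_range_space C mult.assoc)
  qed
  moreover have "ip ?R (?C x) x = ip H (A x) x" if x: "x \<in> carrier ?R" for x
    using mem[OF x] ip_orth_proj[OF mem(3)[OF x] mem(1)[OF x]] by (simp add: ops C)
  ultimately show ?thesis
    using A mem(1) by (simp add: form_between_def hnorm_range_space)
qed

end

end

section \<open>The square of a Hilbert space inside its own universe\<close>

text \<open>The injection \<open>enc\<close> encodes pairs of vectors in the type of vectors. An element of \<open>H \<oplus> H\<close>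
  is then a value of \<open>enc\<close>, so that \<open>H \<oplus> H\<close> is a Hilbert space over the same universe as \<open>H\<close>.\<close>

locale encoded_square = complex_hilbert H for H :: "'a hilbert" (structure) +
  fixes enc :: "'a \<times> 'a \<Rightarrow> 'a"
  assumes inj_enc: "inj_on enc (carrier H \<times> carrier H)"
begin

definition dec :: "'a \<Rightarrow> 'a \<times> 'a" where
  "dec = inv_into (carrier H \<times> carrier H) enc"

definition square :: "'a hilbert" where
  "square = H\<lparr>carrier := enc ` (carrier H \<times> carrier H),
     zero := enc (\<zero>, \<zero>),
     add := (\<lambda>u v. enc (fst (dec u) \<oplus> fst (dec v), snd (dec u) \<oplus> snd (dec v))),
     smult := (\<lambda>c u. enc (c \<odot> fst (dec u), c \<odot> snd (dec u))),
     ip := (\<lambda>u v. ip H (fst (dec u)) (fst (dec v)) + ip H (snd (dec u)) (snd (dec v)))\<rparr>"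

lemma dec_enc [simp]: "\<lbrakk>x \<in> carrier H; y \<in> carrier H\<rbrakk> \<Longrightarrow> dec (enc (x, y)) = (x, y)"
  by (simp add: dec_def inv_into_f_f[OF inj_enc])

lemma enc_eq_iff:
  "\<lbrakk>x \<in> carrier H; y \<in> carrier H; x' \<in> carrier H; y' \<in> carrier H\<rbrakk> \<Longrightarrow>
    enc (x, y) = enc (x', y') \<longleftrightarrow> x = x' \<and> y = y'"
  using inj_on_eq_iff[OF inj_enc, of "(x, y)" "(x', y')"] by simp

lemma square_closed [simp]: "\<lbrakk>x \<in> carrier H; y \<in> carrier H\<rbrakk> \<Longrightarrow> enc (x, y) \<in> carrier square"
  by (simp add: square_def)

lemma square_cases:
  assumes "u \<in> carrier square"
  obtains x y where "x \<in> carrier H" "y \<in> carrier H" "u = enc (x, y)"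
  using assms by (auto simp: square_def)

lemma square_zero: "\<zero>\<^bsub>square\<^esub> = enc (\<zero>, \<zero>)"
  by (simp add: square_def)

lemma square_add [simp]:
  "\<lbrakk>x \<in> carrier H; y \<in> carrier H; x' \<in> carrier H; y' \<in> carrier H\<rbrakk> \<Longrightarrow>
    enc (x, y) \<oplus>\<^bsub>square\<^esub> enc (x', y') = enc (x \<oplus> x', y \<oplus> y')"
  by (simp add: square_def)

lemma square_scale [simp]:
  "\<lbrakk>x \<in> carrier H; y \<in> carrier H\<rbrakk> \<Longrightarrow> c \<odot>\<^bsub>square\<^esub> enc (x, y) = enc (c \<odot> x, c \<odot> y)"
  by (simp add: square_def)

lemma ip_square [simp]:
  "\<lbrakk>x \<in> carrier H; y \<in> carrier H; x' \<in> carrier H; y' \<in> carrier H\<rbrakk> \<Longrightarrow>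
    ip square (enc (x, y)) (enc (x', y')) = ip H x x' + ip H y y'"
  by (simp add: square_def)

lemma inner_product_space_square: "inner_product_space square"
proof -
  have "abelian_group square"
  proof (rule abelian_groupI)
    fix u v w assume uvw: "u \<in> carrier square" "v \<in> carrier square" "w \<in> carrier square"
    then show "u \<oplus>\<^bsub>square\<^esub> v \<oplus>\<^bsub>square\<^esub> w = u \<oplus>\<^bsub>square\<^esub> (v \<oplus>\<^bsub>square\<^esub> w)"
      by (elim square_cases) (simp add: M.a_assoc)
  next
    fix u assume "u \<in> carrier square"
    then obtain x y where xy: "x \<in> carrier H" "y \<in> carrier H" "u = enc (x, y)"
      by (rule square_cases)
    show "\<exists>v\<in>carrier square. v \<oplus>\<^bsub>square\<^esub> u = \<zero>\<^bsub>square\<^esub>"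
      using xy by (intro bexI[of _ "enc (\<ominus> x, \<ominus> y)"]) (simp_all add: square_zero M.l_neg)
  qed (auto elim!: square_cases simp: square_zero M.a_comm)
  moreover have "(c + d) \<odot> x = c \<odot> x \<oplus> d \<odot> x" "(c * d) \<odot> x = c \<odot> (d \<odot> x)" "1 \<odot> x = x"
    "c \<odot> (x \<oplus> y) = c \<odot> x \<oplus> c \<odot> y"
    if "x \<in> carrier H" "y \<in> carrier H" for c d x y
    using that by (intro vec_eqI; simp add: ip_simps algebra_simps)+
  ultimately have "Module.module complex_ring square"
    by (intro moduleI[OF R.is_cring]) (auto elim!: square_cases simp: complex_ring_def)
  moreover have "inner_product_space_axioms square"
  proof
    fix u v w c assume u: "u \<in> carrier square" and v: "v \<in> carrier square"
    show "ip square (c \<odot>\<^bsub>square\<^esub> u) v = c * ip square u v"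
      using u v by (elim square_cases) (simp add: ip_smult_left algebra_simps)
    show "ip square v u = cnj (ip square u v)"
      using u v by (elim square_cases) (simp add: ip_cnj[symmetric])
    assume w: "w \<in> carrier square"
    show "ip square (u \<oplus>\<^bsub>square\<^esub> v) w = ip square u w + ip square v w"
      using u v w by (elim square_cases) (simp add: ip_add_left)
  next
    fix u assume u: "u \<in> carrier square" "u \<noteq> \<zero>\<^bsub>square\<^esub>"
    then obtain x y where xy: "x \<in> carrier H" "y \<in> carrier H" "u = enc (x, y)"
      by (blast elim: square_cases)
    then have "x \<noteq> \<zero> \<or> y \<noteq> \<zero>"
      using u(2) by (auto simp: square_zero)
    then have "hnorm H x \<noteq> 0 \<or> hnorm H y \<noteq> 0"
      using xy hnorm_eq_0 by blast
    then show "0 < Re (ip square u u)"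
      using xy by (simp add: ip_self sum_power2_gt_zero_iff)
  qed
  ultimately show ?thesis
    by (rule inner_product_space.intro)
qed

lemma hnorm_square:
  assumes "x \<in> carrier H" "y \<in> carrier H"
  shows "hnorm square (enc (x, y)) = sqrt ((hnorm H x)\<^sup>2 + (hnorm H y)\<^sup>2)"
  using assms by (simp add: hnorm_def[of square] ip_self)

lemma square_diff:
  assumes "x \<in> carrier H" "y \<in> carrier H" "x' \<in> carrier H" "y' \<in> carrier H"
  shows "enc (x, y) \<ominus>\<^bsub>square\<^esub> enc (x', y') = enc (x \<ominus> x', y \<ominus> y')"
proof -
  interpret K: inner_product_space square
    by (rule inner_product_space_square)
  show ?thesis
    using assms by (simp add: K.diff_conv_add_scale diff_conv_add_scale)
qed

lemma complex_hilbert_square: "complex_hilbert square"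
proof -
  interpret K: inner_product_space square
    by (rule inner_product_space_square)
  have "Metric_space.mcomplete (carrier square) (hdist square)"
    unfolding K.mcomplete_iff
  proof (intro allI impI, elim conjE)
    fix s :: "nat \<Rightarrow> 'a"
    assume s: "range s \<subseteq> carrier square"
      and cauchy: "\<forall>e>0. \<exists>N. \<forall>m\<ge>N. \<forall>n\<ge>N. hnorm square (s m \<ominus>\<^bsub>square\<^esub> s n) < e"
    have "\<exists>x y. x \<in> carrier H \<and> y \<in> carrier H \<and> s n = enc (x, y)" for n
    proof -
      have "s n \<in> enc ` (carrier H \<times> carrier H)"
        using s by (auto simp: square_def)
      then show ?thesis
        by auto
    qed
    then obtain u v where uv: "\<And>n. u n \<in> carrier H" "\<And>n. v n \<in> carrier H" "\<And>n. s n = enc (u n, v n)"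
      by metis
    have s_diff: "hnorm square (s m \<ominus>\<^bsub>square\<^esub> s n)
        = sqrt ((hnorm H (u m \<ominus> u n))\<^sup>2 + (hnorm H (v m \<ominus> v n))\<^sup>2)" for m n
      using uv by (simp add: square_diff hnorm_square)
    have le: "hnorm H (u m \<ominus> u n) \<le> hnorm square (s m \<ominus>\<^bsub>square\<^esub> s n)"
      "hnorm H (v m \<ominus> v n) \<le> hnorm square (s m \<ominus>\<^bsub>square\<^esub> s n)" for m n
      unfolding s_diff by (simp_all add: real_le_rsqrt)
    have component: "\<exists>l\<in>carrier H. (\<lambda>n. hnorm H (r n \<ominus> l)) \<longlonglongrightarrow> 0"
      if r: "\<And>n. r n \<in> carrier H"
        and r_le: "\<And>m n. hnorm H (r m \<ominus> r n) \<le> hnorm square (s m \<ominus>\<^bsub>square\<^esub> s n)" for r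
    proof -
      have "\<exists>N. \<forall>m\<ge>N. \<forall>n\<ge>N. hnorm H (r m \<ominus> r n) < e" if "e > 0" for e
      proof -
        obtain N where "\<forall>m\<ge>N. \<forall>n\<ge>N. hnorm square (s m \<ominus>\<^bsub>square\<^esub> s n) < e"
          using cauchy \<open>e > 0\<close> by blast
        then show ?thesis
          by (intro exI[of _ N] allI impI) (rule order_le_less_trans[OF r_le], blast)
      qed
      moreover have "range r \<subseteq> carrier H"
        using r by blast
      ultimately show ?thesis
        using complete unfolding mcomplete_iff by blast
    qed
    obtain k where k: "k \<in> carrier H" "(\<lambda>n. hnorm H (u n \<ominus> k)) \<longlonglongrightarrow> 0"
      using component[OF uv(1) le(1)] by blast
    obtain l where l: "l \<in> carrier H" "(\<lambda>n. hnorm H (v n \<ominus> l)) \<longlonglongrightarrow> 0"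
      using component[OF uv(2) le(2)] by blast
    have "(\<lambda>n. sqrt ((hnorm H (u n \<ominus> k))\<^sup>2 + (hnorm H (v n \<ominus> l))\<^sup>2)) \<longlonglongrightarrow> sqrt (0\<^sup>2 + 0\<^sup>2)"
      by (intro tendsto_intros k l)
    then show "\<exists>w\<in>carrier square. (\<lambda>n. hnorm square (s n \<ominus>\<^bsub>square\<^esub> w)) \<longlonglongrightarrow> 0"
      using k(1) l(1) uv by (intro bexI[of _ "enc (k, l)"]) (simp_all add: square_diff hnorm_square)
  qed
  then show ?thesis
    by (intro complex_hilbert.intro complex_hilbert_axioms.intro K.module_axioms K.ip_add_left
        K.ip_smult_left K.ip_pos) (auto intro: K.ip_cnj)
qed

definition diag_op :: "('a \<Rightarrow> 'a) \<Rightarrow> ('a \<Rightarrow> 'a) \<Rightarrow> 'a \<Rightarrow> 'a" where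
  "diag_op S T = (\<lambda>u\<in>carrier square. enc (S (fst (dec u)), T (snd (dec u))))"

text \<open>The orthogonal projection of \<open>H \<oplus> H\<close> onto the diagonal.\<close>

definition average :: "'a \<Rightarrow> 'a" where
  "average = (\<lambda>u\<in>carrier square.
     let m = (1/2) \<odot> (fst (dec u) \<oplus> snd (dec u)) in enc (m, m))"

lemma diag_op_enc [simp]:
  "\<lbrakk>x \<in> carrier H; y \<in> carrier H\<rbrakk> \<Longrightarrow> diag_op S T (enc (x, y)) = enc (S x, T y)"
  by (simp add: diag_op_def)

lemma average_enc:
  "\<lbrakk>x \<in> carrier H; y \<in> carrier H\<rbrakk> \<Longrightarrow>
    average (enc (x, y)) = enc ((1/2) \<odot> (x \<oplus> y), (1/2) \<odot> (x \<oplus> y))"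
  by (simp add: average_def Let_def)

lemma average_diagonal: "x \<in> carrier H \<Longrightarrow> (1/2) \<odot> (x \<oplus> x) = x"
  by (rule vec_eqI) (simp_all add: ip_simps)

lemma form_between_diag_op:
  assumes S: "form_between H a b S" and T: "form_between H a b T"
  shows "form_between square a b (diag_op S T)"
proof -
  interpret K: inner_product_space square
    by (rule inner_product_space_square)
  note bS = form_betweenD(1)[OF S] and bT = form_betweenD(1)[OF T]
  note cl = bounded_op_closed[OF bS] bounded_op_closed[OF bT]
  obtain k where k: "0 < k" "\<And>x. x \<in> carrier H \<Longrightarrow> hnorm H (S x) \<le> k * hnorm H x"
    using bounded_op_bound[OF bS] by blast
  obtain l where l: "0 < l" "\<And>x. x \<in> carrier H \<Longrightarrow> hnorm H (T x) \<le> l * hnorm H x"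
    using bounded_op_bound[OF bT] by blast
  have bound: "hnorm square (enc (S x, T y)) \<le> max k l * hnorm square (enc (x, y))"
    if x: "x \<in> carrier H" and y: "y \<in> carrier H" for x y
  proof -
    have "hnorm H (S x) \<le> max k l * hnorm H x"
      by (rule order_trans[OF k(2)[OF x]]) (use x in \<open>simp add: mult_right_mono\<close>)
    then have 1: "(hnorm H (S x))\<^sup>2 \<le> (max k l * hnorm H x)\<^sup>2"
      by (rule power_mono) (simp add: x cl)
    have "hnorm H (T y) \<le> max k l * hnorm H y"
      by (rule order_trans[OF l(2)[OF y]]) (use y in \<open>simp add: mult_right_mono\<close>)
    then have 2: "(hnorm H (T y))\<^sup>2 \<le> (max k l * hnorm H y)\<^sup>2"
      by (rule power_mono) (simp add: y cl)
    have "sqrt ((hnorm H (S x))\<^sup>2 + (hnorm H (T y))\<^sup>2)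
        \<le> sqrt ((max k l)\<^sup>2 * ((hnorm H x)\<^sup>2 + (hnorm H y)\<^sup>2))"
      using 1 2 by (simp add: power_mult_distrib distrib_left)
    also have "\<dots> = max k l * sqrt ((hnorm H x)\<^sup>2 + (hnorm H y)\<^sup>2)"
      using k(1) l(1) by (simp add: real_sqrt_mult)
    finally show ?thesis
      using x y cl by (simp add: hnorm_square)
  qed
  have "bounded_op square (diag_op S T)"
  proof (rule K.bounded_opI[where K = "max k l"])
    fix u v c assume u: "u \<in> carrier square"
    show "diag_op S T u \<in> carrier square"
      using u cl by (elim square_cases) simp
    show "hnorm square (diag_op S T u) \<le> max k l * hnorm square u"
      using u bound by (elim square_cases) simp
    show "diag_op S T (c \<odot>\<^bsub>square\<^esub> u) = c \<odot>\<^bsub>square\<^esub> diag_op S T u"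
      using u cl by (elim square_cases) (simp add: bounded_op_scale[OF bS] bounded_op_scale[OF bT])
    assume v: "v \<in> carrier square"
    show "diag_op S T (u \<oplus>\<^bsub>square\<^esub> v) = diag_op S T u \<oplus>\<^bsub>square\<^esub> diag_op S T v"
      using u v cl by (elim square_cases) (simp add: bounded_op_add[OF bS] bounded_op_add[OF bT])
  qed (simp add: diag_op_def)
  moreover have "ip square (diag_op S T u) u \<in> \<real> \<and> a * (hnorm square u)\<^sup>2 \<le> Re (ip square (diag_op S T u) u)
      \<and> Re (ip square (diag_op S T u) u) \<le> b * (hnorm square u)\<^sup>2" if u: "u \<in> carrier square" for u
    using u
  proof (rule square_cases)
    fix x y assume xy: "x \<in> carrier H" "y \<in> carrier H" "u = enc (x, y)"
    have "ip H (S x) x \<in> \<real> \<and> a * (hnorm H x)\<^sup>2 \<le> Re (ip H (S x) x) \<and> Re (ip H (S x) x) \<le> b * (hnorm H x)\<^sup>2"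
      "ip H (T y) y \<in> \<real> \<and> a * (hnorm H y)\<^sup>2 \<le> Re (ip H (T y) y) \<and> Re (ip H (T y) y) \<le> b * (hnorm H y)\<^sup>2"
      using S T xy by (simp_all add: form_between_def)
    then show ?thesis
      using xy cl by (simp add: hnorm_square distrib_left)
  qed
  ultimately show ?thesis
    by (simp add: form_between_def)
qed

lemma orth_proj_average: "orth_proj square average"
proof -
  interpret K: inner_product_space square
    by (rule inner_product_space_square)
  have cl: "average u \<in> carrier square" if "u \<in> carrier square" for u
    using that by (elim square_cases) (simp add: average_enc)
  have sa: "ip square (average u) v = ip square u (average v)"
    if "u \<in> carrier square" "v \<in> carrier square" for u v
    using that by (elim square_cases) (simp add: average_enc ip_simps algebra_simps)
  have idem: "average (average u) = average u" if "u \<in> carrier square" for u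
    using that by (elim square_cases) (simp add: average_enc average_diagonal)
  have "bounded_op square average"
  proof (rule K.bounded_opI[where K = 1])
    fix u v c assume u: "u \<in> carrier square"
    show "average u \<in> carrier square"
      using cl[OF u] .
    show "hnorm square (average u) \<le> 1 * hnorm square u"
    proof -
      \<comment> \<open>A self-adjoint idempotent has norm at most 1, by the Cauchy-Schwarz inequality.\<close>
      have "complex_of_real ((hnorm square (average u))\<^sup>2) = ip square (average u) u"
        using K.ip_self[OF cl[OF u]] sa[OF cl[OF u] u] idem[OF u] sa[OF u cl[OF u]] by simp
      then have "cmod (complex_of_real ((hnorm square (average u))\<^sup>2)) \<le> hnorm square (average u) * hnorm square u"
        using K.cauchy_schwarz[OF cl[OF u] u] by metis
      then have "hnorm square (average u) * hnorm square (average u) \<le> hnorm square (average u) * hnorm square u"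
        unfolding norm_of_real by (simp add: power2_eq_square)
      then show ?thesis
        using K.hnorm_nonneg[OF cl[OF u]] K.hnorm_nonneg[OF u]
        by (cases "hnorm square (average u) = 0") (auto simp: mult_le_cancel_left)
    qed
    show "average (c \<odot>\<^bsub>square\<^esub> u) = c \<odot>\<^bsub>square\<^esub> average u"
    proof -
      have "(1/2) \<odot> (c \<odot> x \<oplus> c \<odot> y) = c \<odot> ((1/2) \<odot> (x \<oplus> y))" if "x \<in> carrier H" "y \<in> carrier H" for x y
        using that by (intro vec_eqI) (simp_all add: ip_simps algebra_simps)
      then show ?thesis
        using u by (elim square_cases) (simp add: average_enc)
    qed
    assume v: "v \<in> carrier square"
    show "average (u \<oplus>\<^bsub>square\<^esub> v) = average u \<oplus>\<^bsub>square\<^esub> average v"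
    proof -
      have "(1/2) \<odot> ((x \<oplus> x') \<oplus> (y \<oplus> y')) = (1/2) \<odot> (x \<oplus> y) \<oplus> (1/2) \<odot> (x' \<oplus> y')"
        if "x \<in> carrier H" "y \<in> carrier H" "x' \<in> carrier H" "y' \<in> carrier H" for x y x' y'
        using that by (intro vec_eqI) (simp_all add: ip_simps algebra_simps)
      then show ?thesis
        using u v by (elim square_cases) (simp add: average_enc)
    qed
  qed (simp add: average_def)
  then show ?thesis
    using sa idem by (simp add: orth_proj_def self_adjoint_def)
qed

text \<open>Strong operator convexity for \<open>diag(S, T)\<close> and the projection onto the diagonal, at the
  vector \<open>(x, 0)\<close>. The compression is \<open>M\<close> under \<open>z \<mapsto> (z, z)\<close>. This map doubles inner products
  and the projection of \<open>(x, 0)\<close> is the image of \<open>x/2\<close>, whence the factor \<open>2 (1/2)\<^sup>2 = 1/2\<close>.\<close>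

lemma SOC_half_midpoint:
  assumes g: "g \<in> SOC TYPE('a) {0<..}" and nontriv: "carrier H \<noteq> {\<zero>}" and a: "0 < a"
    and S: "form_between H a b S" and T: "form_between H a b T" and M: "form_between H a b M"
    and mid: "\<And>x. x \<in> carrier H \<Longrightarrow> M x = (1/2) \<odot> (S x \<oplus> T x)"
    and x: "x \<in> carrier H"
  shows "ip H (cfc H g S x) x - (1/2) * ip H (cfc H g M x) x \<in> \<real>\<^sub>\<ge>\<^sub>0"
proof -
  interpret K: complex_hilbert square
    by (rule complex_hilbert_square)
  let ?D = "diag_op S T" and ?P = average
  let ?R = "range_space square ?P" and ?C = "compression square ?P ?D"
  note P = orth_proj_average
  interpret R: complex_hilbert ?R
    by (rule K.complex_hilbert_range_space[OF P])
  have D: "form_between square a b ?D"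
    by (rule form_between_diag_op[OF S T])
  have C: "form_between ?R a b ?C"
    by (rule K.form_between_compression[OF P D])
  note cl = bounded_op_closed[OF form_betweenD(1)[OF S]] bounded_op_closed[OF form_betweenD(1)[OF T]]
    bounded_op_closed[OF form_betweenD(1)[OF M]]
  have "continuous_on {0<..} g"
    using g by (simp add: SOC_def)
  then have cont: "continuous_on {a..b} g"
    by (rule continuous_on_subset) (use a in auto)
  obtain y where "y \<in> carrier H" "y \<noteq> \<zero>"
    using nontriv M.zero_closed by blast
  then have "enc (y, \<zero>) \<in> carrier square" "enc (y, \<zero>) \<noteq> \<zero>\<^bsub>square\<^esub>"
    by (simp_all add: square_zero enc_eq_iff)
  then have "carrier square \<noteq> {\<zero>\<^bsub>square\<^esub>}"
    by blast
  moreover have "spectrum square ?D \<subseteq> complex_of_real ` {0<..}"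
    using K.spectrum_form_between[OF D] image_mono[of "{a..b}" "{0<..}" complex_of_real] a
    by (simp add: subset_iff)
  ultimately have le: "op_le square (cfc_compression square g ?P ?D) (cfc square g ?D)"
    by (intro g[unfolded SOC_def mem_Collect_eq, THEN conjunct2, THEN conjunct2, rule_format]
        conjI complex_hilbert_square K.form_betweenD(2)[OF D] P)
  define u where "u = enc (x, \<zero>)"
  define h where "h = (1/2) \<odot> x"
  define w where "w = cfc ?R g ?C (?P u)"
  have h: "h \<in> carrier H" and u: "u \<in> carrier square"
    using x by (simp_all add: h_def u_def)
  have Pu: "?P u = enc (h, h)"
    using x by (simp add: u_def h_def average_enc)
  have diagR: "enc (z, z) \<in> carrier ?R" if "z \<in> carrier H" for z
    using that by (simp add: range_space_def K.orth_proj_range_iff[OF P] average_enc average_diagonal)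
  have "w \<in> carrier ?R"
    unfolding w_def Pu
    by (rule R.bounded_op_closed[OF R.bounded_op_cfc[OF C cont] diagR[OF h]])
  then have w: "w \<in> carrier square" "?P w = w"
    by (simp_all add: range_space_def K.orth_proj_range_iff[OF P])
  have fD: "cfc square g ?D u \<in> carrier square"
    by (rule K.bounded_op_closed[OF K.bounded_op_cfc[OF D cont] u])
  have "ip square (cfc square g ?D u \<ominus>\<^bsub>square\<^esub> ?P w) u \<in> \<real>\<^sub>\<ge>\<^sub>0"
    using le u by (simp add: op_le_def op_nonneg_def op_diff_def cfc_compression_def w_def)
  moreover have "ip square (cfc square g ?D u) u = 1 * ip H (cfc H g S x) x"
    unfolding u_def
  proof (rule cfc_intertwining[where J = "\<lambda>z. enc (z, \<zero>)" and H = H])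
    show "complex_hilbert H" "complex_hilbert square"
      by (rule complex_hilbert_axioms, rule complex_hilbert_square)
    show "enc (S z, \<zero>) = ?D (enc (z, \<zero>))" if "z \<in> carrier H" for z
      using that by (simp add: bounded_op_zero[OF form_betweenD(1)[OF T]])
  qed (use S D cont x in simp_all)
  moreover have "ip square w u = (1/2) * ip H (cfc H g M x) x"
  proof -
    have "ip square w u = ip ?R w (enc (h, h))"
      using K.ip_orth_proj[OF P w(1) u] w(2) by (simp add: Pu range_space_def)
    also have "\<dots> = 2 * ip H (cfc H g M h) h"
      unfolding w_def Pu
    proof (rule cfc_intertwining[where J = "\<lambda>z. enc (z, z)" and H = H])
      show "complex_hilbert H" "complex_hilbert ?R"
        by (rule complex_hilbert_axioms, rule R.complex_hilbert_axioms)
      show "enc (M z, M z) = ?C (enc (z, z))" if z: "z \<in> carrier H" for z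
        using z cl diagR[OF z] by (simp add: compression_def range_space_def average_enc mid)
    qed (use M C cont diagR h in \<open>simp_all add: range_space_def\<close>)
    also have "\<dots> = (1/2) * ip H (cfc H g M x) x"
      using x bounded_op_closed[OF bounded_op_cfc[OF M cont] x]
      by (simp add: h_def bounded_op_scale[OF bounded_op_cfc[OF M cont]] ip_simps)
    finally show ?thesis .
  qed
  ultimately show ?thesis
    using w u fD by (simp add: K.ip_diff_left)
qed

end

section \<open>Subadditivity\<close>

context complex_hilbert begin

lemma form_between_mono:
  "\<lbrakk>form_between H a b A; a' \<le> a; b \<le> b'\<rbrakk> \<Longrightarrow> form_between H a' b' A"
  unfolding form_between_def
  by (meson mult_right_mono order_trans zero_le_power2)

lemma form_between_op_add:
  assumes A: "form_between H a b A" and B: "form_between H a' b' B"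
  shows "form_between H (a + a') (b + b') (op_add H A B)"
  unfolding form_between_def
proof (intro conjI ballI)
  note bA = form_betweenD(1)[OF A] and bB = form_betweenD(1)[OF B]
  show "bounded_op H (op_add H A B)"
    by (rule bounded_op_op_add[OF bA bB])
  fix x assume x: "x \<in> carrier H"
  have eq: "ip H (op_add H A B x) x = ip H (A x) x + ip H (B x) x"
    using x bounded_op_closed[OF bA x] bounded_op_closed[OF bB x] by (simp add: op_add_def ip_add_left)
  have "ip H (A x) x \<in> \<real> \<and> a * (hnorm H x)\<^sup>2 \<le> Re (ip H (A x) x) \<and> Re (ip H (A x) x) \<le> b * (hnorm H x)\<^sup>2"
    "ip H (B x) x \<in> \<real> \<and> a' * (hnorm H x)\<^sup>2 \<le> Re (ip H (B x) x) \<and> Re (ip H (B x) x) \<le> b' * (hnorm H x)\<^sup>2"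
    using A B x by (simp_all add: form_between_def)
  then show "ip H (op_add H A B x) x \<in> \<real>" "(a + a') * (hnorm H x)\<^sup>2 \<le> Re (ip H (op_add H A B x) x)"
    "Re (ip H (op_add H A B x) x) \<le> (b + b') * (hnorm H x)\<^sup>2"
    unfolding eq by (simp_all add: distrib_right)
qed

text \<open>Nonnegativity of the form at \<open>x - A x / L\<close>, where \<open>L\<close> bounds \<open>A\<close>, yields \<open>\<parallel>A x\<parallel>\<^sup>2 \<le> L \<langle>A
  x, x\<rangle>\<close>. A bound \<open>K\<close> of the inverse gives \<open>\<parallel>x\<parallel> \<le> K \<parallel>A x\<parallel>\<close>, and together \<open>\<parallel>x\<parallel>\<^sup>2 \<le> L K\<^sup>2 \<langle>A x,
  x\<rangle>\<close>.\<close>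

lemma positive_invertible_form_between:
  assumes A: "bounded_op H A" and pos: "op_nonneg H A" and inv: "op_invertible H A"
  shows "\<exists>a b. 0 < a \<and> 0 < b \<and> form_between H a b A"
proof -
  note cl = bounded_op_closed[OF A]
  have re: "ip H (A x) x \<in> \<real>" and nn: "0 \<le> Re (ip H (A x) x)" if "x \<in> carrier H" for x
    using pos that by (auto simp: op_nonneg_def complex_nonneg_Reals_iff complex_is_Real_iff)
  have sa: "self_adjoint H A"
    by (rule self_adjoint_of_real_form[OF A re])
  obtain L where L: "0 < L" "\<And>x. x \<in> carrier H \<Longrightarrow> hnorm H (A x) \<le> L * hnorm H x"
    using bounded_op_bound[OF A] by blast
  obtain S where S: "bounded_op H S" "\<And>x. x \<in> carrier H \<Longrightarrow> S (A x) = x"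
    using inv unfolding op_invertible_def by blast
  obtain K where K: "0 < K" "\<And>x. x \<in> carrier H \<Longrightarrow> hnorm H (S x) \<le> K * hnorm H x"
    using bounded_op_bound[OF S(1)] by blast
  have upper: "Re (ip H (A x) x) \<le> L * (hnorm H x)\<^sup>2" if x: "x \<in> carrier H" for x
  proof -
    have "Re (ip H (A x) x) \<le> hnorm H (A x) * hnorm H x"
      using complex_Re_le_cmod cauchy_schwarz[OF cl[OF x] x] by (rule order_trans)
    also have "\<dots> \<le> L * hnorm H x * hnorm H x"
      using L(2)[OF x] x by (intro mult_right_mono) simp_all
    finally show ?thesis
      by (simp add: power2_eq_square mult.assoc)
  qed
  have lower: "1 / (L * K\<^sup>2) * (hnorm H x)\<^sup>2 \<le> Re (ip H (A x) x)" if x: "x \<in> carrier H" for x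
  proof -
    define t where "t = 1 / L"
    define y where "y = A x"
    have y: "y \<in> carrier H"
      using cl[OF x] by (simp add: y_def)
    have Ay: "A y \<in> carrier H"
      by (rule cl[OF y])
    have sym: "ip H (A y) x = of_real ((hnorm H y)\<^sup>2)" "ip H (A x) y = of_real ((hnorm H y)\<^sup>2)"
      using sa x y ip_self[OF y] by (simp_all add: self_adjoint_def y_def)
    let ?z = "x \<ominus> complex_of_real t \<odot> y"
    have "0 \<le> Re (ip H (A ?z) ?z)"
      using nn[of ?z] x y by simp
    also have "ip H (A ?z) ?z
        = ip H (A x) x - of_real (2 * t * (hnorm H y)\<^sup>2) + of_real (t\<^sup>2) * ip H (A y) y"
      using x y cl[OF x] Ay
      by (simp add: bounded_op_diff[OF A] bounded_op_scale[OF A] ip_simps sym algebra_simps power2_eq_square)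
    finally have "0 \<le> Re (ip H (A x) x) - 2 * t * (hnorm H y)\<^sup>2 + t\<^sup>2 * Re (ip H (A y) y)"
      by simp
    also have "t\<^sup>2 * Re (ip H (A y) y) \<le> t\<^sup>2 * (L * (hnorm H y)\<^sup>2)"
      using upper[OF y] by (intro mult_left_mono) simp_all
    also have "t\<^sup>2 * (L * (hnorm H y)\<^sup>2) = t * (hnorm H y)\<^sup>2"
      using L(1) by (simp add: t_def power2_eq_square)
    finally have "t * (hnorm H y)\<^sup>2 \<le> Re (ip H (A x) x)"
      by simp
    moreover have "(hnorm H x)\<^sup>2 \<le> (K * hnorm H y)\<^sup>2"
      using K(2)[OF y] S(2)[OF x] x by (intro power_mono) (simp_all add: y_def)
    then have "1 / (L * K\<^sup>2) * (hnorm H x)\<^sup>2 \<le> t * (hnorm H y)\<^sup>2"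
      using L(1) K(1) by (simp add: t_def field_simps power_mult_distrib)
    ultimately show ?thesis
      by linarith
  qed
  have "form_between H (1 / (L * K\<^sup>2)) L A"
    using A re upper lower by (simp add: form_between_def)
  then show ?thesis
    using L(1) K(1) by (intro exI[of _ "1 / (L * K\<^sup>2)"] exI[of _ L]) simp
qed

text \<open>The carrier contains a complex line.\<close>

lemma infinite_carrier:
  assumes "carrier H \<noteq> {\<zero>}"
  shows "infinite (carrier H)"
proof -
  obtain x where x: "x \<in> carrier H" "x \<noteq> \<zero>"
    using assms M.zero_closed by blast
  have "inj (\<lambda>c. c \<odot> x)"
  proof (rule injI)
    fix c d assume "c \<odot> x = d \<odot> x"
    then have "c * ip H x x = d * ip H x x"
      using ip_smult_left[OF x(1) x(1)] by metis
    then show "c = d"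
      using ip_pos[OF x] by auto
  qed
  then have "infinite (range (\<lambda>c. c \<odot> x))"
    using finite_imageD infinite_UNIV_char_0 by blast
  moreover have "range (\<lambda>c. c \<odot> x) \<subseteq> carrier H"
    using x(1) by auto
  ultimately show ?thesis
    using finite_subset by blast
qed

end

lemma infinite_Times_inj:
  assumes "infinite A"
  obtains f :: "'a \<times> 'a \<Rightarrow> 'a" where "inj_on f (A \<times> A)"
  using card_of_Times_same_infinite[OF assms] unfolding card_of_ordIso[symmetric] bij_betw_def
  by blast

text \<open>The sum \<open>A + B\<close> is the average of \<open>A\<close> and \<open>A + 2B\<close>; all three forms lie between \<open>a\<close> and
  \<open>3b\<close>.\<close>

lemma SOC_half_add:
  fixes H :: "'a hilbert"
  assumes g: "g \<in> SOC TYPE('a) {0<..}" and H: "complex_hilbert H" and nontriv: "carrier H \<noteq> {\<zero>\<^bsub>H\<^esub>}"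
    and a: "0 < a" and b: "0 < b" and A: "form_between H a b A" and B: "form_between H a b B"
    and x: "x \<in> carrier H"
  shows "ip H (cfc H g A x) x - (1/2) * ip H (cfc H g (op_add H A B) x) x \<in> \<real>\<^sub>\<ge>\<^sub>0"
proof -
  interpret complex_hilbert H by fact
  obtain enc :: "'a \<times> 'a \<Rightarrow> 'a" where "inj_on enc (carrier H \<times> carrier H)"
    using infinite_Times_inj[OF infinite_carrier[OF nontriv]] .
  then interpret encoded_square H enc
    by unfold_locales
  let ?T = "op_add H A (op_add H B B)"
  note cl = bounded_op_closed[OF form_betweenD(1)[OF A]] bounded_op_closed[OF form_betweenD(1)[OF B]]
  have S': "form_between H a (3 * b) A"
    using A b by (rule_tac form_between_mono) auto
  have T': "form_between H a (3 * b) ?T"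
    using a b by (intro form_between_mono[OF form_between_op_add[OF A form_between_op_add[OF B B]]]) auto
  have M': "form_between H a (3 * b) (op_add H A B)"
    using a b by (intro form_between_mono[OF form_between_op_add[OF A B]]) auto
  have "op_add H A B z = (1/2) \<odot>\<^bsub>H\<^esub> (A z \<oplus>\<^bsub>H\<^esub> ?T z)" if "z \<in> carrier H" for z
    using that cl[of z] by (intro vec_eqI) (simp_all add: op_add_def ip_simps)
  then show ?thesis
    by (rule SOC_half_midpoint[OF g nontriv a S' T' M' _ x])
qed

theorem proposition2p1:
  fixes g :: "real \<Rightarrow> real"
    and H :: "'a hilbert"
    and A B :: "'a \<Rightarrow> 'a"
  assumes "g \<in> SOC TYPE('a) {0<..}"
    and "\<exists>t\<in>{0<..}. g t \<noteq> 0"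
    and "complex_hilbert H" and "carrier H \<noteq> {\<zero>\<^bsub>H\<^esub>}"
    and "bounded_op H A" and "op_nonneg H A" and "op_invertible H A"
    and "bounded_op H B" and "op_nonneg H B" and "op_invertible H B"
  shows "op_le H (cfc H g (op_add H A B)) (op_add H (cfc H g A) (cfc H g B))"
proof -
  interpret complex_hilbert H by fact
  obtain a1 b1 where 1: "0 < a1" "0 < b1" "form_between H a1 b1 A"
    using positive_invertible_form_between[OF assms(5-7)] by blast
  obtain a2 b2 where 2: "0 < a2" "0 < b2" "form_between H a2 b2 B"
    using positive_invertible_form_between[OF assms(8-10)] by blast
  define a b where "a = min a1 a2" and "b = max b1 b2"
  have a: "0 < a" and b: "0 < b"
    using 1 2 by (simp_all add: a_def b_def)
  have A: "form_between H a b A" and B: "form_between H a b B"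
    using form_between_mono[OF 1(3)] form_between_mono[OF 2(3)] by (simp_all add: a_def b_def)
  have AB: "form_between H a (2 * b) (op_add H A B)"
    using a by (intro form_between_mono[OF form_between_op_add[OF A B]]) auto
  have comm: "op_add H B A = op_add H A B"
    using bounded_op_closed[OF assms(5)] bounded_op_closed[OF assms(8)]
    by (auto simp: op_add_def fun_eq_iff restrict_def M.a_comm)
  have "continuous_on {0<..} g"
    using assms(1) by (simp add: SOC_def)
  then have cont: "continuous_on {a..c} g" for c
    by (rule continuous_on_subset) (use a in auto)
  note cl = bounded_op_closed[OF bounded_op_cfc[OF A cont]] bounded_op_closed[OF bounded_op_cfc[OF B cont]]
    bounded_op_closed[OF bounded_op_cfc[OF AB cont]]
  show ?thesis
    unfolding op_le_def op_nonneg_def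
  proof
    fix x assume x: "x \<in> carrier H"
    have "ip H (op_diff H (op_add H (cfc H g A) (cfc H g B)) (cfc H g (op_add H A B)) x) x
      = (ip H (cfc H g A x) x - (1/2) * ip H (cfc H g (op_add H A B) x) x)
        + (ip H (cfc H g B x) x - (1/2) * ip H (cfc H g (op_add H A B) x) x)"
      using x cl[OF x] by (simp add: op_diff_def op_add_def ip_simps)
    then show "ip H (op_diff H (op_add H (cfc H g A) (cfc H g B)) (cfc H g (op_add H A B)) x) x \<in> \<real>\<^sub>\<ge>\<^sub>0"
      using nonneg_Reals_add_I[OF SOC_half_add[OF assms(1,3,4) a b A B x]
          SOC_half_add[OF assms(1,3,4) a b B A x]]
      by (simp add: comm)
  qed
qed

end
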